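(* For each integer $n\ge 0$, the group $\mathfrak G_n$ has a normal subgroup $H_n$ of index $2^{2^{n+1}+2}$ which is isomorphic to the direct product of $2^n$ free groups of rank $3$.
   Context: Let $\mathfrak G_{-1}=\langle a,b,c,d\mid a^2=b^2=c^2=d^2=bcd=1\rangle$. Let $\sigma$ be the endomorphism of $\mathfrak G_{-1}$ defined by $\sigma(a)=aca$, $\sigma(b)=d$, $\sigma(c)=b$, $\sigma(d)=c$. Set $u_0=(ad)^4$, $v_0=(adacac)^4$, $u_n=\sigma^n(u_0)$, $v_n=\sigma^n(v_0)$ for $n\ge0$. For $n\ge 0$, $\mathfrak G_n$ is the group with presentation $\langle a,b,c,d\mid a^2=b^2=c^2=d^2=bcd=1,\ u_0=\dots=u_n=1,\ v_0=\dots=v_{n-1}=1\rangle$ (for $n=0$, no $v_i$ relators). (These groups converge to the Grigorchuk group, which has the Lysenok presentation with all relators $u_n,v_n$.) *)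

theory Defs
  imports "HOL-Algebra.Algebra"
begin

text \<open>A word over generators of type 'a: a list of letters (g, e); e = True means
  the inverse g^-1 of the generator g.\<close>

type_synonym 'a word = "('a \<times> bool) list"

definition inv_letter :: "'a \<times> bool \<Rightarrow> 'a \<times> bool" where
  "inv_letter x = (fst x, \<not> snd x)"

definition inv_word :: "'a word \<Rightarrow> 'a word" where
  "inv_word w = rev (map inv_letter w)"

inductive pres_eq :: "'a word set \<Rightarrow> 'a word \<Rightarrow> 'a word \<Rightarrow> bool" for R where
  pe_refl: "pres_eq R w w"
| pe_sym: "pres_eq R w w' \<Longrightarrow> pres_eq R w' w"
| pe_trans: "pres_eq R u v \<Longrightarrow> pres_eq R v w \<Longrightarrow> pres_eq R u w"
| pe_cancel: "pres_eq R (u @ [x, inv_letter x] @ v) (u @ v)"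
| pe_rel: "r \<in> R \<Longrightarrow> pres_eq R (u @ r @ v) (u @ v)"

definition pclass :: "'a word set \<Rightarrow> 'a word \<Rightarrow> 'a word set" where
  "pclass R w = {w'. pres_eq R w w'}"

definition pres_group :: "'a set \<Rightarrow> 'a word set \<Rightarrow> 'a word set monoid" where
  "pres_group S R =
     \<lparr> carrier = pclass R ` lists (S \<times> UNIV),
       monoid.mult = (\<lambda>P Q. {w. \<exists>x\<in>P. \<exists>y\<in>Q. pres_eq R (x @ y) w}),
       one = pclass R [] \<rparr>"

definition free_group3 :: "nat word set monoid" where
  "free_group3 = pres_group {0, 1, 2} {}"

datatype gen = Ga | Gb | Gc | Gd

definition lt :: "gen \<Rightarrow> gen \<times> bool" where
  "lt g = (g, False)"

text \<open>Substitution of words for generators (extended to inverse letters by inverse words);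
  on G_{-1} this induces the endomorphism with the given images of generators.\<close>

definition subst :: "(gen \<Rightarrow> gen word) \<Rightarrow> gen word \<Rightarrow> gen word" where
  "subst f w = concat (map (\<lambda>x. if snd x then inv_word (f (fst x)) else f (fst x)) w)"

fun sigma_gen :: "gen \<Rightarrow> gen word" where
  "sigma_gen Ga = map lt [Ga, Gc, Ga]"
| "sigma_gen Gb = map lt [Gd]"
| "sigma_gen Gc = map lt [Gb]"
| "sigma_gen Gd = map lt [Gc]"

definition sigma :: "gen word \<Rightarrow> gen word" where
  "sigma = subst sigma_gen"

definition u0 :: "gen word" where
  "u0 = concat (replicate 4 (map lt [Ga, Gd]))"

definition v0 :: "gen word" where
  "v0 = concat (replicate 4 (map lt [Ga, Gd, Ga, Gc, Ga, Gc]))"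

definition u :: "nat \<Rightarrow> gen word" where
  "u n = (sigma ^^ n) u0"

definition v :: "nat \<Rightarrow> gen word" where
  "v n = (sigma ^^ n) v0"

definition base_rels :: "gen word set" where
  "base_rels = {map lt [Ga, Ga], map lt [Gb, Gb], map lt [Gc, Gc], map lt [Gd, Gd],
                map lt [Gb, Gc, Gd]}"

definition rels :: "nat \<Rightarrow> gen word set" where
  "rels n = base_rels \<union> {u i | i. i \<le> n} \<union> {v i | i. i < n}"

definition Grig :: "nat \<Rightarrow> gen word set monoid" where
  "Grig n = pres_group UNIV (rels n)"

end

theory Submission
  imports Defs
begin

text \<open>
  The case \<open>n = 0\<close>: \<open>G\<^sub>0\<close> is the semidirect product of \<open>B = \<langle>b\<^sub>1\<rangle> * \<dots> * \<langle>b\<^sub>4\<rangle>\<close> (the conjugates of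
  \<open>b\<close>) with the dihedral group \<open>\<langle>a, d\<rangle>\<close> of order 8, and the words of even length in \<open>B\<close> form a
  normal subgroup of index 16, free on \<open>b\<^sub>1b\<^sub>2, b\<^sub>1b\<^sub>3, b\<^sub>1b\<^sub>4\<close>. Freeness is seen from an action of
  \<open>G\<^sub>0\<close> on \<open>F\<^sub>3 \<times> {0,1}\<close> in which these elements act by left translation.

  The step: the wreath recursion \<open>b \<mapsto> (a,c), c \<mapsto> (a,d), d \<mapsto> (1,b)\<close>, with \<open>a\<close> swapping coordinates,
  embeds the index-2 subgroup \<open>Q\<close> of words with an even number of \<open>a\<close>'s in \<open>G\<^sub>n\<^sub>+\<^sub>1\<close> into
  \<open>G\<^sub>n \<times> G\<^sub>n\<close>. It is well defined since every relator is \<open>u\<^sub>0\<close>, \<open>v\<^sub>0\<close> or \<open>\<sigma>(r)\<close> for an earlier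
  fourth power \<open>r\<close>, and \<open>\<sigma>(r) \<mapsto> (f(r), r)\<close> where \<open>f\<close> takes values in a dihedral group of exponent 4.
  It is injective since \<open>u\<^sub>0, v\<^sub>0\<close> make the conjugates of \<open>d\<close> under \<open>\<langle>c, aca\<rangle>\<close> commute with \<open>ada\<close>, so
  that every element of \<open>Q\<close> is \<open>a\<sigma>(x)a\<sigma>(y)\<close> with \<open>x\<close> in the normal closure of \<open>b\<close>; its second
  coordinate is \<open>y\<close> and, if \<open>y = 1\<close>, its first one is \<open>x\<close>. The image is the fibre product of two copies of
  \<open>G\<^sub>n\<close> over the dihedral group of order 8, so the preimage of \<open>H\<^sub>n \<times> H\<^sub>n\<close> has the right index.

  Since all generators are involutions, words are represented by lists of generators without signs.
\<close>

section \<open>Unsigned words and equality in \<open>G_n\<close>\<close>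

fun sigma_letter :: "gen \<Rightarrow> gen list" where
  "sigma_letter Ga = [Ga, Gc, Ga]" | "sigma_letter Gb = [Gd]" | "sigma_letter Gc = [Gb]" | "sigma_letter Gd = [Gc]"

definition sigma_list :: "gen list \<Rightarrow> gen list" where
  "sigma_list w = concat (map sigma_letter w)"

lemma sigma_list_simps [simp]: "sigma_list [] = []" "sigma_list (x # w) = sigma_letter x @ sigma_list w" "sigma_list (w @ y) = sigma_list w @ sigma_list y"
  by (simp_all add: sigma_list_def)

text \<open>All relators other than the base ones have this form, so they die in every quotient of
  exponent 4.\<close>

definition fourth :: "gen list \<Rightarrow> gen list" where
  "fourth x = x @ x @ x @ x"

lemma sigma_list_fourth: "sigma_list (fourth x) = fourth (sigma_list x)"
  by (simp add: fourth_def)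

definition base_list :: "gen list set" where
  "base_list = {[Ga, Ga], [Gb, Gb], [Gc, Gc], [Gd, Gd], [Gb, Gc, Gd]}"

definition u_list :: "nat \<Rightarrow> gen list" where
  "u_list n = fourth ((sigma_list ^^ n) [Ga, Gd])"

definition v_list :: "nat \<Rightarrow> gen list" where
  "v_list n = fourth ((sigma_list ^^ n) [Ga, Gd, Ga, Gc, Ga, Gc])"

lemma sigma_list_u_list: "sigma_list (u_list n) = u_list (Suc n)" and sigma_list_v_list: "sigma_list (v_list n) = v_list (Suc n)"
  by (simp_all add: u_list_def v_list_def sigma_list_fourth)

definition rel_list :: "nat \<Rightarrow> gen list set" where
  "rel_list n = base_list \<union> {u_list i | i. i \<le> n} \<union> {v_list i | i. i < n}"

text \<open>Equality in \<open>G_n\<close>. As the squares of the letters are base relators,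
  \<open>rel\<close> also supplies cancellation, and \<open>rev\<close> is inversion.\<close>

inductive weq :: "nat \<Rightarrow> gen list \<Rightarrow> gen list \<Rightarrow> bool" for n where
  refl: "weq n w w"
| sym: "weq n x y \<Longrightarrow> weq n y x"
| trans [trans]: "weq n x y \<Longrightarrow> weq n y z \<Longrightarrow> weq n x z"
| rel: "r \<in> rel_list n \<Longrightarrow> weq n (x @ r @ y) (x @ y)"

declare weq.refl [simp]

lemma weq_app_left: "weq n x y \<Longrightarrow> weq n (z @ x) (z @ y)"
proof (induction rule: weq.induct)
  case (rel r x y)
  show ?case using weq.rel[OF rel, of "z @ x" y] by simp
qed (auto intro: weq.intros)

lemma weq_app_right: "weq n x y \<Longrightarrow> weq n (x @ z) (y @ z)"
proof (induction rule: weq.induct)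
  case (rel r x y)
  show ?case using weq.rel[OF rel, of x "y @ z"] by simp
qed (auto intro: weq.intros)

lemma weq_append: "weq n x x' \<Longrightarrow> weq n y y' \<Longrightarrow> weq n (x @ y) (x' @ y')"
  by (meson weq.trans weq_app_left weq_app_right)

lemma weq_Cons: "weq n x y \<Longrightarrow> weq n (g # x) (g # y)"
  using weq_app_left[of n x y "[g]"] by simp

lemma rel_list_mono: "m \<le> n \<Longrightarrow> rel_list m \<subseteq> rel_list n"
  by (force simp: rel_list_def)

lemma weq_mono: "weq m x y \<Longrightarrow> m \<le> n \<Longrightarrow> weq n x y"
proof (induction rule: weq.induct)
  case (rel r x y)
  then show ?case using rel_list_mono weq.rel by blast
qed (auto intro: weq.intros)

lemma weq_rel_Nil: "r \<in> rel_list n \<Longrightarrow> weq n r []"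
  using weq.rel[of r n "[]" "[]"] by simp

lemma weq_double: "weq n (g # g # w) w"
proof -
  have "[g, g] \<in> rel_list n" by (cases g) (auto simp: rel_list_def base_list_def)
  from weq.rel[OF this, of "[]" w] show ?thesis by simp
qed

lemma weq_rev_right: "weq n (x @ rev x) []"
proof (induction x)
  case (Cons g x)
  have "weq n ([g] @ (x @ rev x) @ [g]) ([g] @ [] @ [g])"
    by (intro weq_append Cons weq.refl)
  also have "weq n ([g] @ [] @ [g]) []" using weq_double[of n g "[]"] by simp
  finally show ?case by simp
qed simp

lemma weq_rev_left: "weq n (rev x @ x) []"
  using weq_rev_right[of n "rev x"] by simp

lemma weq_rev: assumes "weq n x y" shows "weq n (rev x) (rev y)"
proof -
  have "weq n (rev x) (rev x @ (y @ rev y))"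
    using weq_append[OF weq.refl weq.sym[OF weq_rev_right]] by (metis append.right_neutral)
  also have "weq n (rev x @ (y @ rev y)) ((rev x @ x) @ rev y)"
    using weq_append[OF weq_append[OF weq.refl weq.sym[OF assms]] weq.refl] by (metis append.assoc)
  also have "weq n ((rev x @ x) @ rev y) (rev y)"
    using weq_append[OF weq_rev_left weq.refl] by (metis append_Nil)
  finally show ?thesis .
qed

text \<open>The normal form in \<open>\<langle>a\<rangle> * {1,b,c,d}\<close> turns equality modulo the base relators into a
  computation.\<close>

fun third :: "gen \<Rightarrow> gen \<Rightarrow> gen" where
  "third Gb Gc = Gd" | "third Gc Gb = Gd" | "third Gb Gd = Gc" | "third Gd Gb = Gc"
| "third Gc Gd = Gb" | "third Gd Gc = Gb" | "third x y = x"

fun push :: "gen \<Rightarrow> gen list \<Rightarrow> gen list" where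
  "push x [] = [x]"
| "push x (y # w) = (if x = y then w else if x = Ga \<or> y = Ga then x # y # w else third x y # w)"

definition nf :: "gen list \<Rightarrow> gen list" where
  "nf w = foldr push w []"

lemma nf_simps [simp]: "nf [] = []" "nf (x # w) = push x (nf w)"
  by (simp_all add: nf_def)

lemma weq_third:
  assumes "x \<noteq> y" "x \<noteq> Ga" "y \<noteq> Ga"
  shows "weq n (x # y # w) (third x y # w)"
proof -
  have bcd: "weq n (p @ [Gb, Gc, Gd] @ q) (p @ q)" for p q
    by (rule weq.rel) (simp add: rel_list_def base_list_def)
  have r: "weq n [Gb,Gc] [Gd]"
    using bcd[of "[]" "[Gd]"] weq_app_left[OF weq_double[of n Gd "[]"], of "[Gb,Gc]"]
    by simp (meson weq.trans weq.sym)
  have r2: "weq n [Gc,Gd] [Gb]"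
    using bcd[of "[Gb]" "[]"] weq_double[of n Gb "[Gc,Gd]"]
    by simp (meson weq.trans weq.sym)
  have r3: "weq n [Gd,Gc] [Gb]" using weq_rev[OF r2] by simp
  have r4: "weq n [Gc,Gb] [Gd]" using weq_rev[OF r] by simp
  have r5: "weq n [Gd,Gb] [Gc]"
    using weq_app_right[OF weq.sym[OF r4], of "[Gb]"] weq_app_left[OF weq_double[of n Gb "[]"], of "[Gc]"]
    by simp (meson weq.trans weq.sym)
  have r6: "weq n [Gb,Gd] [Gc]" using weq_rev[OF r5] by simp
  have "weq n [x,y] [third x y]"
    using assms r r2 r3 r4 r5 r6 by (cases x; cases y; simp)
  from weq_app_right[OF this, of w] show ?thesis by simp
qed

lemma weq_push: "weq n (x # w) (push x w)"
  by (cases w) (auto simp: weq_double weq_third)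

lemma weq_nf: "weq n w (nf w)"
proof (induction w)
  case (Cons x w)
  show ?case using weq.trans[OF weq_Cons[OF Cons] weq_push] by simp
qed simp

lemma weq_if_nf_eq: "nf x = nf y \<Longrightarrow> weq n x y"
  by (metis weq.sym weq.trans weq_nf)

text \<open>Serves identities that use one further relator: \<open>p\<close> and \<open>q\<close>
  say where it is inserted, the rest is evaluation of \<open>nf\<close>.\<close>

lemma weq_if_rel:
  assumes "r \<in> rel_list n" "nf x = nf (p @ r @ q)" "nf y = nf (p @ q)"
  shows "weq n x y"
  using weq_if_nf_eq[OF assms(2)] weq.rel[OF assms(1)] weq_if_nf_eq[OF assms(3)[symmetric]]
  by (meson weq.trans)

text \<open>The relator (ad)^4 says that (ad)^2 is its own inverse; equivalently, d commutes with
  ada.\<close>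

lemma adad_comm: "weq 0 [Ga,Gd,Ga,Gd] [Gd,Ga,Gd,Ga]"
  by (rule weq_if_rel[of "u_list 0" _ _ "[]" "[Gd,Ga,Gd,Ga]"]) (auto simp: rel_list_def u_list_def fourth_def)

subsection \<open>Sections\<close>

text \<open>Coordinates of the wreath recursion, \<open>False\<close> for the first and
  \<open>True\<close> for the second. The letter a contributes nothing; in \<open>sec\<close> it
  switches the coordinate being read.\<close>

fun sec_letter :: "bool \<Rightarrow> gen \<Rightarrow> gen list" where
  "sec_letter i Ga = []"
| "sec_letter i Gb = (if i then [Gc] else [Ga])"
| "sec_letter i Gc = (if i then [Gd] else [Ga])"
| "sec_letter i Gd = (if i then [Gb] else [])"

fun sec :: "bool \<Rightarrow> gen list \<Rightarrow> gen list" where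
  "sec i [] = []"
| "sec i (x # w) = sec_letter i x @ sec (i \<noteq> (x = Ga)) w"

fun par :: "gen list \<Rightarrow> bool" where
  "par [] = False"
| "par (x # w) = (par w \<noteq> (x = Ga))"

lemma par_append [simp]: "par (x @ y) = (par x \<noteq> par y)"
  by (induction x) auto

lemma sec_append [simp]: "sec i (x @ y) = sec i x @ sec (i \<noteq> par x) y"
  by (induction x arbitrary: i) (auto intro!: arg_cong2[of _ _ _ _ sec])

fun sec0_sigma_letter :: "gen \<Rightarrow> gen list" where
  "sec0_sigma_letter Ga = [Gd]" | "sec0_sigma_letter Gb = []" | "sec0_sigma_letter Gc = [Ga]" | "sec0_sigma_letter Gd = [Ga]"

text \<open>The first coordinate of the wreath recursion on the image of \<open>\<sigma>\<close>.\<close>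

definition sec0_sigma :: "gen list \<Rightarrow> gen list" where
  "sec0_sigma w = concat (map sec0_sigma_letter w)"

lemma sec0_sigma_simps [simp]: "sec0_sigma [] = []" "sec0_sigma (x # w) = sec0_sigma_letter x @ sec0_sigma w" "sec0_sigma (w @ y) = sec0_sigma w @ sec0_sigma y"
  by (simp_all add: sec0_sigma_def)

lemma par_sigma_list [simp]: "\<not> par (sigma_list w)"
proof (induction w)
  case (Cons x w) then show ?case by (cases x) auto
qed simp

lemma sec_True_sigma_list [simp]: "sec True (sigma_list w) = w"
proof (induction w)
  case (Cons x w) then show ?case by (cases x) auto
qed simp

lemma sec_False_sigma_list [simp]: "sec False (sigma_list w) = sec0_sigma w"
proof (induction w)
  case (Cons x w) then show ?case by (cases x) (auto)
qed simp

fun bd :: "gen list \<Rightarrow> bool" where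
  "bd [] = False"
| "bd (x # w) = (bd w \<noteq> (x = Gb \<or> x = Gd))"

fun bc :: "gen list \<Rightarrow> bool" where
  "bc [] = False"
| "bc (x # w) = (bc w \<noteq> (x = Gb \<or> x = Gc))"

lemma bd_append [simp]: "bd (x @ y) = (bd x \<noteq> bd y)" and bc_append [simp]: "bc (x @ y) = (bc x \<noteq> bc y)"
  by (induction x) auto

text \<open>The first three entries are the image in the dihedral group of order 8, seen as the wreath
  product of two groups of order 2 (\<open>b \<mapsto> 1\<close>, \<open>a\<close> is the swap); the last one is the character with
  kernel the normal closure of \<open>a\<close> and \<open>d\<close>.\<close>

definition quot16 :: "gen list \<Rightarrow> bool list" where
  "quot16 w = [par w, bd (sec False w), bd (sec True w), bc w]"

abbreviation quot16_one :: "bool list" where "quot16_one \<equiv> [False, False, False, False]"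

lemma quot16_Nil [simp]: "quot16 [] = quot16_one" by (simp add: quot16_def)

text \<open>\<open>quot16\<close> is a homomorphism to a group of order 16. These congruences
  replace a multiplication on bit lists; the parity of the left factor decides whether the
  coordinates of the right one are swapped.\<close>

lemma quot16_left: "quot16 x = quot16 x' \<Longrightarrow> quot16 (x @ y) = quot16 (x' @ y)"
  and quot16_right: "quot16 y = quot16 y' \<Longrightarrow> quot16 (x @ y) = quot16 (x @ y')"
  by (cases "par x"; auto simp: quot16_def)+

lemma quot16_append_quot16_one: "quot16 x = quot16_one \<Longrightarrow> quot16 (x @ y) = quot16 y"
  using quot16_left[of x "[]" y] by simp

text \<open>The dihedral group of order 8 times a group of order 2 has exponent 4.\<close>

lemma quot16_fourth: "quot16 (fourth x) = quot16_one"
  by (cases "par x") (auto simp: quot16_def fourth_def)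

lemma quot16_rel: "r \<in> rel_list n \<Longrightarrow> quot16 r = quot16_one"
  by (auto simp: rel_list_def base_list_def u_list_def v_list_def quot16_fourth) (auto simp: quot16_def)

lemma quot16_weq: "weq n x y \<Longrightarrow> quot16 x = quot16 y"
proof (induction rule: weq.induct)
  case (rel r x y)
  show ?case using quot16_append_quot16_one[OF quot16_rel[OF rel]] quot16_right by metis
qed auto

text \<open>Both sides count the letters c and d modulo 2: the sections of b, c, d are (a,c), (a,d),
  (1,b), and only the last two pairs contain a letter b or d, exactly one each.\<close>

lemma bd_bc: "(bd w \<noteq> bc w) = (bd (sec False w) \<noteq> bd (sec True w))"
proof (induction w)
  case (Cons x w) then show ?case by (cases x) auto
qed simp

lemma bc_sec: "bc w = (par (sec False w) \<noteq> par (sec True w))"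
proof (induction w)
  case (Cons x w) then show ?case by (cases x) auto
qed simp

text \<open>\<open>bd_bc\<close>, applied to each section, recovers its \<open>bd\<close> from its
  own \<open>quot16\<close>, and \<open>bc_sec\<close> gives the last entry. Hence the deeper
  quotients refine this one.\<close>

lemma quot16_sec:
  assumes "par x = par y" "quot16 (sec False x) = quot16 (sec False y)" "quot16 (sec True x) = quot16 (sec True y)"
  shows "quot16 x = quot16 y"
proof -
  have "bd (sec i x) = bd (sec i y)" for i
    using assms(2,3) bd_bc[of "sec i x"] bd_bc[of "sec i y"] by (cases i) (auto simp: quot16_def)
  moreover have "bc x = bc y" using assms(2,3) unfolding bc_sec by (auto simp: quot16_def)
  ultimately show ?thesis using assms(1) by (simp add: quot16_def)
qed

subsection \<open>The dihedral quotient\<close>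

definition dihedral :: "gen list \<Rightarrow> bool list" where
  "dihedral w = [par w, bd (sec False w), bd (sec True w)]"

lemma quot16_dihedral: "quot16 w = dihedral w @ [bc w]" by (simp add: quot16_def dihedral_def)

lemma dihedral_Nil [simp]: "dihedral [] = [False, False, False]" by (simp add: dihedral_def)

lemma dihedral_weq: "weq n x y \<Longrightarrow> dihedral x = dihedral y"
  using quot16_weq[of n x y] by (simp add: quot16_dihedral)

lemma dihedral_left: "dihedral x = dihedral x' \<Longrightarrow> dihedral (x @ y) = dihedral (x' @ y)"
  and dihedral_right: "dihedral y = dihedral y' \<Longrightarrow> dihedral (x @ y) = dihedral (x @ y')"
  by (cases "par x"; auto simp: dihedral_def)+

text \<open>The representative in <a, d> of the element with these coordinates: ada and d generate
  the two factors of the base group, and a swaps them.\<close>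

definition dihedral_word :: "bool \<Rightarrow> bool \<Rightarrow> bool \<Rightarrow> gen list" where
  "dihedral_word p e f = (if e then [Ga, Gd, Ga] else []) @ (if f then [Gd] else []) @ (if p then [Ga] else [])"

fun swap_ad :: "gen \<Rightarrow> gen" where "swap_ad Ga = Gd" | "swap_ad Gd = Ga" | "swap_ad x = x"

lemma weq_ul0: "nf y = nf (u_list 0 @ x) \<Longrightarrow> weq 0 x y"
  using weq_if_rel[of "u_list 0" 0 y "[]" x x] weq.sym by (simp add: rel_list_def)

lemma dihedral_word_a: "weq 0 (Ga # dihedral_word p e f) (dihedral_word (\<not> p) f e)"
  \<comment> \<open>Each of the eight cases holds modulo the base relators or after inserting (ad)^4
    in front of one of the two sides.\<close>
  by (cases p; cases e; cases f;
      ((rule weq_if_nf_eq, (simp add: dihedral_word_def; fail)) |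
       (rule weq_ul0, (simp add: dihedral_word_def u_list_def fourth_def; fail)) |
       (rule weq.sym, rule weq_ul0, simp add: dihedral_word_def u_list_def fourth_def)))

lemma dihedral_word_d: "weq 0 (Gd # dihedral_word p e f) (dihedral_word p e (\<not> f))"
  by (cases p; cases e; cases f;
      ((rule weq_if_nf_eq, (simp add: dihedral_word_def; fail)) |
       (rule weq_ul0, (simp add: dihedral_word_def u_list_def fourth_def; fail)) |
       (rule weq.sym, rule weq_ul0, simp add: dihedral_word_def u_list_def fourth_def)))

lemma dihedral_word_swap_ad: "weq 0 (Gd # map swap_ad (dihedral_word p e f)) (map swap_ad (dihedral_word (\<not> p) f e))"
  by (cases p; cases e; cases f;
      ((rule weq_if_nf_eq, (simp add: dihedral_word_def; fail)) |
       (rule weq_ul0, (simp add: dihedral_word_def u_list_def fourth_def; fail)) |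
       (rule weq.sym, rule weq_ul0, simp add: dihedral_word_def u_list_def fourth_def)))

lemma dihedral_word_dd: "weq 0 (Ga # map swap_ad (dihedral_word p e f)) (map swap_ad (dihedral_word p e (\<not> f)))"
  by (cases p; cases e; cases f;
      ((rule weq_if_nf_eq, (simp add: dihedral_word_def; fail)) |
       (rule weq_ul0, (simp add: dihedral_word_def u_list_def fourth_def; fail)) |
       (rule weq.sym, rule weq_ul0, simp add: dihedral_word_def u_list_def fourth_def)))

definition dihedral_part :: "gen list \<Rightarrow> gen list" where
  "dihedral_part w = dihedral_word (par w) (bd (sec False w)) (bd (sec True w))"

lemma dihedral_part_trivial: "dihedral w = [False, False, False] \<Longrightarrow> dihedral_part w = []"
  by (simp add: dihedral_def dihedral_part_def dihedral_word_def)

lemma dihedral_part_Cons: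
  "weq 0 (Ga # dihedral_part w) (dihedral_part (Ga # w))" "dihedral_part (Gb # w) = dihedral_part w"
  "weq 0 (Gd # dihedral_part w) (dihedral_part (Gc # w))" "weq 0 (Gd # dihedral_part w) (dihedral_part (Gd # w))"
  using dihedral_word_a dihedral_word_d by (auto simp: dihedral_part_def)

text \<open>Both sides come from a \<mapsto> d, b \<mapsto> 1, c, d \<mapsto> a: first the map to
  <a, d> with b \<mapsto> 1 and c \<mapsto> d, then the exchange of a and d. So the first coordinate
  of \<sigma>(w) depends only on the dihedral image of w.\<close>

lemma sec0_sigma_weq: "weq 0 (sec0_sigma w) (map swap_ad (dihedral_part w))"
proof (induction w)
  case Nil
  then show ?case by (simp add: dihedral_part_def dihedral_word_def)
next
  case (Cons x w)
  have "weq 0 (sec0_sigma (x # w)) (sec0_sigma_letter x @ map swap_ad (dihedral_part w))"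
    using weq_app_left[OF Cons] by simp
  also have "weq 0 (sec0_sigma_letter x @ map swap_ad (dihedral_part w)) (map swap_ad (dihedral_part (x # w)))"
    using dihedral_word_swap_ad dihedral_word_dd by (cases x) (auto simp: dihedral_part_def)
  finally show ?case .
qed

lemma sec0_sigma_trivial: "dihedral w = [False, False, False] \<Longrightarrow> weq n (sec0_sigma w) []"
  using sec0_sigma_weq[of w] weq_mono by (force simp: dihedral_part_trivial)

section \<open>Compatibility of the wreath recursion and \<sigma> with the relators\<close>

lemma dihedral_fourth: "dihedral (fourth x) = [False, False, False]"
  using quot16_fourth[of x] by (simp add: quot16_dihedral)

text \<open>The sections of \<open>u_list 0\<close> and \<open>v_list 0\<close> vanish modulo the
  base relators. A later relator is \<sigma>(r) with r a relator one level down; its sections are r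
  and \<open>sec0_sigma r\<close>, the latter trivial because r is a fourth power.\<close>

lemma sec_rel:
  assumes "r \<in> rel_list (Suc n)"
  shows "\<not> par r \<and> weq n (sec i r) []"
proof -
  have p: "\<not> par r" using quot16_rel[OF assms] by (simp add: quot16_def)
  have sigma_list: "weq n (sec i (sigma_list r')) []" if "r' \<in> rel_list n" "dihedral r' = [False, False, False]" for r'
    using sec0_sigma_trivial[OF that(2)] weq_rel_Nil[OF that(1)] by (cases i) simp_all
  consider "r \<in> base_list" | "r = u_list 0" | k where "r = u_list (Suc k)" "k \<le> n" |
     "r = v_list 0" | k where "r = v_list (Suc k)" "k < n"
    using assms unfolding rel_list_def
    by simp (metis less_Suc_eq_le not0_implies_Suc not_less_eq Suc_le_mono Suc_less_eq)
  then have "weq n (sec i r) []"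
  proof cases
    case 1 then show ?thesis by (intro weq_if_nf_eq) (auto simp: base_list_def)
  next
    case 2 then show ?thesis by (intro weq_if_nf_eq) (auto simp: u_list_def fourth_def)
  next
    case 3 then show ?thesis unfolding \<open>r = u_list (Suc k)\<close> sigma_list_u_list[symmetric]
      by (intro sigma_list) (auto simp: rel_list_def u_list_def dihedral_fourth)
  next
    case 4 then show ?thesis by (intro weq_if_nf_eq) (auto simp: v_list_def fourth_def)
  next
    case 5 then show ?thesis unfolding \<open>r = v_list (Suc k)\<close> sigma_list_v_list[symmetric]
      by (intro sigma_list) (auto simp: rel_list_def v_list_def dihedral_fourth)
  qed
  with p show ?thesis by simp
qed

lemma par_weq: "weq n x y \<Longrightarrow> par x = par y"
  using quot16_weq[of n x y] by (simp add: quot16_def)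

lemma sec_weq: "weq (Suc n) x y \<Longrightarrow> weq n (sec i x) (sec i y)"
proof (induction arbitrary: i rule: weq.induct)
  case (rel r x y)
  have "weq n (sec i x @ sec (i \<noteq> par x) r @ sec (i \<noteq> par x) y) (sec i x @ [] @ sec (i \<noteq> par x) y)"
    by (intro weq_append weq.refl) (use sec_rel[OF rel] in blast)
  then show ?case using sec_rel[OF rel] by simp
qed (auto intro: weq.intros)

lemma sigma_list_weq: "weq n x y \<Longrightarrow> weq (Suc n) (sigma_list x) (sigma_list y)"
proof (induction rule: weq.induct)
  case (rel r x y)
  have "weq (Suc n) (sigma_list r) []"
  proof (cases "r \<in> base_list")
    case True then show ?thesis by (intro weq_if_nf_eq) (auto simp: base_list_def)
  next
    case False
    with rel have "sigma_list r \<in> rel_list (Suc n)" by (auto simp: rel_list_def sigma_list_u_list sigma_list_v_list)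
    then show ?thesis by (rule weq_rel_Nil)
  qed
  then have "weq (Suc n) (sigma_list x @ sigma_list r @ sigma_list y) (sigma_list x @ [] @ sigma_list y)"
    by (intro weq_append weq.refl)
  then show ?case by simp
qed (auto intro: weq.intros)

subsection \<open>The free group of rank three\<close>

abbreviation feq :: "nat word \<Rightarrow> nat word \<Rightarrow> bool" where "feq \<equiv> pres_eq {}"

declare pres_eq.pe_trans [trans]

lemma pres_eq_app_left: "pres_eq R x y \<Longrightarrow> pres_eq R (z @ x) (z @ y)"
proof (induction rule: pres_eq.induct)
  case (pe_cancel x l y)
  show ?case using pres_eq.pe_cancel[of R "z @ x" l y] by simp
next
  case (pe_rel r x y)
  show ?case using pres_eq.pe_rel[OF pe_rel, of "z @ x" y] by simp
qed (auto intro: pres_eq.intros)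

lemma pres_eq_app_right: "pres_eq R x y \<Longrightarrow> pres_eq R (x @ z) (y @ z)"
proof (induction rule: pres_eq.induct)
  case (pe_cancel x l y)
  show ?case using pres_eq.pe_cancel[of R x l "y @ z"] by simp
next
  case (pe_rel r x y)
  show ?case using pres_eq.pe_rel[OF pe_rel, of x "y @ z"] by simp
qed (auto intro: pres_eq.intros)

lemma pres_eq_append: "pres_eq R x x' \<Longrightarrow> pres_eq R y y' \<Longrightarrow> pres_eq R (x @ y) (x' @ y')"
  by (meson pres_eq.pe_trans pres_eq_app_left pres_eq_app_right)

lemma inv_letter_inv_letter [simp]: "inv_letter (inv_letter x) = x"
  by (simp add: inv_letter_def)

lemma inv_word_simps [simp]: "inv_word [] = []" "inv_word (x # w) = inv_word w @ [inv_letter x]"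
  "inv_word (w @ y) = inv_word y @ inv_word w"
  by (simp_all add: inv_word_def)

lemma inv_word_inv_word [simp]: "inv_word (inv_word w) = w"
  by (induction w) auto

lemma pres_eq_inv_right: "pres_eq R (w @ inv_word w) []"
proof (induction w)
  case Nil
  then show ?case by (simp add: pres_eq.pe_refl)
next
  case (Cons x w)
  have "pres_eq R ([x] @ (w @ inv_word w) @ [inv_letter x]) ([x] @ [] @ [inv_letter x])"
    by (intro pres_eq_append Cons pres_eq.pe_refl)
  also have "pres_eq R ([x] @ [] @ [inv_letter x]) []"
    using pres_eq.pe_cancel[of R "[]" x "[]"] by simp
  finally show ?case by simp
qed

lemma pres_eq_inv_left: "pres_eq R (inv_word w @ w) []"
  using pres_eq_inv_right[of R "inv_word w"] by simp

fun free_push :: "'a \<times> bool \<Rightarrow> 'a word \<Rightarrow> 'a word" where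
  "free_push x [] = [x]"
| "free_push x (y # w) = (if y = inv_letter x then w else x # y # w)"

definition free_red :: "'a word \<Rightarrow> 'a word" where "free_red w = foldr free_push w []"

lemma pres_eq_free_red: "pres_eq R w (free_red w)"
proof (induction w)
  case Nil
  then show ?case by (simp add: free_red_def pres_eq.pe_refl)
next
  case (Cons x w)
  have "pres_eq R (x # w') (free_push x w')" for w'
    using pres_eq.pe_cancel[of R "[]" x] by (cases w') (auto intro: pres_eq.pe_refl)
  moreover have "pres_eq R (x # w) (x # free_red w)" using pres_eq_app_left[OF Cons, of "[x]"] by simp
  ultimately show ?case by (metis (no_types, lifting) free_red_def foldr.simps(2) o_apply pres_eq.pe_trans)
qed

lemma pres_eq_if_free_red: "free_red x = free_red y \<Longrightarrow> pres_eq R x y"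
  by (metis pres_eq.pe_sym pres_eq.pe_trans pres_eq_free_red)

definition subst_word :: "('a \<times> bool \<Rightarrow> 'b word) \<Rightarrow> 'a word \<Rightarrow> 'b word" where
  "subst_word h w = concat (map h w)"

lemma subst_word_simps [simp]: "subst_word h [] = []" "subst_word h (x # w) = h x @ subst_word h w"
  "subst_word h (w @ y) = subst_word h w @ subst_word h y"
  by (simp_all add: subst_word_def)

lemma subst_word_cong:
  assumes h: "\<And>x. h (inv_letter x) = inv_word (h x)" and "pres_eq {} x y"
  shows "pres_eq {} (subst_word h x) (subst_word h y)"
  using assms(2)
proof (induction rule: pres_eq.induct)
  case (pe_cancel x l y)
  have "pres_eq {} (subst_word h x @ (h l @ inv_word (h l)) @ subst_word h y) (subst_word h x @ [] @ subst_word h y)"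
    by (intro pres_eq_append pres_eq.pe_refl pres_eq_inv_right)
  then show ?case by (simp add: h)
qed (auto intro: pres_eq.intros)

section \<open>Automorphisms of the free group induced by b, d and a\<close>

definition flip_letter :: "nat \<times> bool \<Rightarrow> nat word" where "flip_letter x = [inv_letter x]"

definition swap_letter :: "nat \<times> bool \<Rightarrow> nat word" where
  "swap_letter x = [((if fst x = 0 then 1 else if fst x = 1 then 0 else fst x), snd x)]"

text \<open>With x_i = b b_i, conjugation by b inverts each x_i, that by d exchanges x_0 and x_1,
  and that by a exchanges b with b_0 and b_1 with b_2, which gives these images. The last branch
  keeps the identities below true for all words over \<open>nat\<close>.\<close>

definition alpha_gen :: "nat \<Rightarrow> nat word" where
  "alpha_gen i = (if i = 0 then [(0, True)] else if i = 1 then [(0, True), (2, False)]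
     else if i = 2 then [(0, True), (1, False)] else [(0, True), (i, False)])"

definition alpha_letter :: "nat \<times> bool \<Rightarrow> nat word" where
  "alpha_letter x = (if snd x then inv_word (alpha_gen (fst x)) else alpha_gen (fst x))"

abbreviation "flip \<equiv> subst_word flip_letter"
abbreviation "swap \<equiv> subst_word swap_letter"
abbreviation "alpha \<equiv> subst_word alpha_letter"

lemma flip_letter_inv: "flip_letter (inv_letter x) = inv_word (flip_letter x)"
  and swap_letter_inv: "swap_letter (inv_letter x) = inv_word (swap_letter x)"
  and alpha_letter_inv: "alpha_letter (inv_letter x) = inv_word (alpha_letter x)"
  by (auto simp: flip_letter_def swap_letter_def alpha_letter_def inv_letter_def)

lemma flip_cong: "feq x y \<Longrightarrow> feq (flip x) (flip y)"
  and swap_cong: "feq x y \<Longrightarrow> feq (swap x) (swap y)"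
  and alpha_cong: "feq x y \<Longrightarrow> feq (alpha x) (alpha y)"
  by (simp_all add: subst_word_cong flip_letter_inv swap_letter_inv alpha_letter_inv)

lemma flip_flip [simp]: "flip (flip w) = w"
  by (induction w) (auto simp: flip_letter_def)

lemma swap_swap [simp]: "swap (swap w) = w"
  by (induction w) (auto simp: swap_letter_def)

lemma flip_swap: "flip (swap w) = swap (flip w)"
  by (induction w) (auto simp: swap_letter_def flip_letter_def inv_letter_def)

lemma letter_cases:
  obtains s where "x = (0, s)" | s where "x = (1, s)" | s where "x = (2::nat, s)"
  | i s where "x = (i, s)" "i \<noteq> 0" "i \<noteq> Suc 0" "i \<noteq> 2"
  by (metis surj_pair One_nat_def)

lemma alpha_alpha: "feq (alpha (alpha w)) w"
proof (induction w)
  case Nil then show ?case by (simp add: pres_eq.pe_refl)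
next
  case (Cons x w)
  have "feq (alpha (alpha [x])) [x]"
    by (cases x rule: letter_cases; cases "snd x"; rule pres_eq_if_free_red;
        simp add: alpha_letter_def alpha_gen_def free_red_def inv_letter_def)
  from pres_eq_append[OF this Cons] show ?case by simp
qed

text \<open>Conjugation by aba = b_0 = x_0^{-1} b is conjugation by b followed by that by
  x_0^{-1}.\<close>

lemma alpha_flip_alpha: "feq (alpha (flip (alpha w))) ((0, True) # flip w @ [(0, False)])"
proof (induction w)
  case Nil then show ?case using pres_eq.pe_sym[OF pres_eq.pe_cancel[of "{}" "[]" "(0, True)" "[]"]]
    by (simp add: inv_letter_def)
next
  case (Cons x w)
  have "feq (alpha (flip (alpha [x]))) ([(0,True)] @ flip_letter x @ [(0,False)])"
    by (cases x rule: letter_cases; cases "snd x"; rule pres_eq_if_free_red;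
        simp add: alpha_letter_def alpha_gen_def free_red_def inv_letter_def flip_letter_def)
  from pres_eq_append[OF this Cons]
  have "feq (alpha (flip (alpha (x # w)))) (((0,True) # flip_letter x) @ [(0,False), inv_letter (0, False)] @ flip w @ [(0,False)])"
    by (simp add: inv_letter_def)
  also have "feq ... (((0,True) # flip_letter x) @ flip w @ [(0,False)])"
    by (rule pres_eq.pe_cancel)
  finally show ?case by simp
qed

lemma alpha_swap_fourth: "feq (alpha (swap (alpha (swap (alpha (swap (alpha (swap w)))))))) w"
proof (induction w)
  case Nil then show ?case by (simp add: pres_eq.pe_refl)
next
  case (Cons x w)
  have "feq (alpha (swap (alpha (swap (alpha (swap (alpha (swap [x])))))))) [x]"
    by (cases x rule: letter_cases; cases "snd x"; rule pres_eq_if_free_red;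
        simp add: alpha_letter_def alpha_gen_def free_red_def inv_letter_def swap_letter_def)
  from pres_eq_append[OF this Cons] show ?case by simp
qed

text \<open>The action of \<open>G\<^sub>0\<close> on the cosets of \<open>\<langle>a, d\<rangle>\<close>: the pair \<open>(w, e)\<close> stands for the coset of
  \<open>w b\<^sup>e\<close>, with the letters of \<open>w\<close> denoting \<open>b b\<^sub>i\<close> for the three conjugates \<open>b\<^sub>i \<noteq> b\<close> of \<open>b\<close>.\<close>

type_synonym state = "nat word \<times> bool"

text \<open>The letter is moved to the right past w and b^e: w is conjugated, ab = b_0 a = x_0^{-1}
  b a produces the extra \<open>(0, True)\<close>, and c acts as bd.\<close>

fun act :: "gen \<Rightarrow> state \<Rightarrow> state" where
  "act Ga (w, e) = (alpha w @ (if e then [(0, True)] else []), e)"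
| "act Gb (w, e) = (flip w, \<not> e)"
| "act Gc (w, e) = (flip (swap w), \<not> e)"
| "act Gd (w, e) = (swap w, e)"

definition acts :: "gen list \<Rightarrow> state \<Rightarrow> state" where "acts w = foldr act w"

lemma acts_simps [simp]: "acts [] s = s" "acts (x # w) s = act x (acts w s)"
  "acts (w @ y) s = acts w (acts y s)"
  by (simp_all add: acts_def)

definition state_eq :: "state \<Rightarrow> state \<Rightarrow> bool" where
  "state_eq s t \<longleftrightarrow> feq (fst s) (fst t) \<and> snd s = snd t"

lemma state_eq_refl [simp]: "state_eq s s" by (simp add: state_eq_def pres_eq.pe_refl)
lemma state_eq_sym: "state_eq s t \<Longrightarrow> state_eq t s" by (simp add: state_eq_def pres_eq.pe_sym)
lemma state_eq_trans [trans]: "state_eq s t \<Longrightarrow> state_eq t r \<Longrightarrow> state_eq s r"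
  unfolding state_eq_def by (metis pres_eq.pe_trans)

lemma act_cong: "state_eq s t \<Longrightarrow> state_eq (act x s) (act x t)"
  by (cases s; cases t; cases x)
    (auto simp: state_eq_def intro!: flip_cong swap_cong alpha_cong pres_eq_append pres_eq.pe_refl)

lemma acts_cong: "state_eq s t \<Longrightarrow> state_eq (acts w s) (acts w t)"
  by (induction w) (auto intro: act_cong)

lemma acts_rel:
  assumes "r \<in> rel_list 0" shows "state_eq (acts r s) s"
proof -
  obtain w e where s: "s = (w, e)" by (cases s)
  have c: "feq (x @ [(0, True)] @ [(0, False)] @ y) (x @ y)" "feq (x @ [(0, False)] @ [(0, True)] @ y) (x @ y)" for x y
    using pres_eq.pe_cancel[of "{}" x "(0, True)" y] pres_eq.pe_cancel[of "{}" x "(0, False)" y]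
    by (auto simp: inv_letter_def)
  consider "r = [Ga, Ga]" | "r \<in> {[Gb, Gb], [Gc, Gc], [Gd, Gd], [Gb, Gc, Gd]}" | "r = u_list 0"
    using assms by (auto simp: rel_list_def base_list_def)
  then show ?thesis
  proof cases
    case 1
    show ?thesis
    proof (cases e)
      case True
      have "feq (alpha (alpha w) @ [(0, False), (0, True)]) (w @ [])"
        by (intro pres_eq_append alpha_alpha pres_eq_if_free_red) (simp add: free_red_def inv_letter_def)
      then show ?thesis using 1 s True by (simp add: state_eq_def alpha_letter_def alpha_gen_def inv_letter_def)
    qed (use alpha_alpha 1 s in \<open>simp add: state_eq_def\<close>)
  next
    case 2 then show ?thesis using s by (auto simp: flip_swap)
  next
    case 3
    show ?thesis
    proof (cases e)
      case True
      let ?b = "\<lambda>w. alpha (swap w)"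
      \<comment> \<open>For e = 1 each a leaves a letter x_0^{-1}; carried through the later factors
        ad, the four pieces multiply to 1.\<close>
      have "feq (?b (?b (?b (?b w))) @ ?b (?b (?b [(0, True)])) @ ?b (?b [(0, True)]) @ ?b [(0, True)] @ [(0, True)]) (w @ [])"
        by (intro pres_eq_append alpha_swap_fourth pres_eq_if_free_red)
          (simp add: alpha_letter_def alpha_gen_def free_red_def inv_letter_def swap_letter_def)
      then show ?thesis using 3 s True by (simp add: state_eq_def u_list_def fourth_def)
    qed (use alpha_swap_fourth 3 s in \<open>simp add: state_eq_def u_list_def fourth_def\<close>)
  qed
qed

text \<open>The action descends to \<open>G_0\<close>, so an equality in \<open>G_0\<close> yields
  one in the free group.\<close>

lemma acts_weq: "weq 0 x y \<Longrightarrow> state_eq (acts x s) (acts y s)"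
proof (induction rule: weq.induct)
  case (rel r x y)
  show ?case by (simp add: acts_cong acts_rel rel)
qed (auto intro: state_eq_sym state_eq_trans)

section \<open>The free subgroup of \<open>G_0\<close>\<close>

fun b_conj :: "nat \<Rightarrow> gen list" where
  "b_conj i = (if i = 0 then [Ga, Gb, Ga] else if i = 1 then [Gd, Ga, Gb, Ga, Gd]
    else [Ga, Gd, Ga, Gb, Ga, Gd, Ga])"

definition iota_letter :: "nat \<times> bool \<Rightarrow> gen list" where
  "iota_letter x = (if snd x then b_conj (fst x) @ [Gb] else Gb # b_conj (fst x))"

definition iota :: "nat word \<Rightarrow> gen list" where
  "iota w = concat (map iota_letter w)"

lemma iota_simps [simp]: "iota [] = []" "iota (x # w) = iota_letter x @ iota w" "iota (w @ y) = iota w @ iota y"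
  by (simp_all add: iota_def)

text \<open>Letters are arbitrary natural numbers, while the elements of \<open>free_group3\<close>
  are represented by words in 0, 1, 2.\<close>

definition rank3 :: "nat word \<Rightarrow> bool" where
  "rank3 w \<longleftrightarrow> w \<in> lists ({0, 1, 2} \<times> UNIV)"

lemma rank3_simps [simp]: "rank3 []" "rank3 ((i, s) # w) \<longleftrightarrow> (i = 0 \<or> i = 1 \<or> i = 2) \<and> rank3 w"
  "rank3 (w @ y) \<longleftrightarrow> rank3 w \<and> rank3 y"
  by (auto simp: rank3_def)

lemma rank3_letter_cases:
  assumes "rank3 (x # w)" 
  obtains "x = (0, True)" | "x = (0, False)" | "x = (1, True)" | "x = (1, False)" | "x = (2, True)" | "x = (2, False)"
  using assms by (cases x; cases "snd x") auto

lemma rank3_subst_word: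
  assumes "rank3 w" "\<And>x w. rank3 (x # w) \<Longrightarrow> rank3 (h x)"
  shows "rank3 (subst_word h w)"
  using assms(1)
proof (induction w)
  case (Cons x w)
  then show ?case using assms(2)[OF Cons.prems] by (cases x) auto
qed simp

lemma rank3_hom: "rank3 w \<Longrightarrow> rank3 (flip w)" "rank3 w \<Longrightarrow> rank3 (swap w)" "rank3 w \<Longrightarrow> rank3 (alpha w)"
  by (erule rank3_subst_word, erule rank3_letter_cases;
      simp add: flip_letter_def swap_letter_def alpha_letter_def alpha_gen_def inv_letter_def)+

lemma rank3_acts: "rank3 (fst s) \<Longrightarrow> rank3 (fst (acts w s))"
proof (induction w)
  case (Cons x w)
  then show ?case by (cases x; cases "acts w s") (auto intro: rank3_hom)
qed simp

text \<open>As b_0 = x_0^{-1} b, it acts like b followed by left translation by x_0^{-1}.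
  Conjugating by d and then by a gives the same for b_1 and b_2.\<close>

lemma acts_b0: "state_eq (acts (b_conj 0) (w, e)) ((0, True) # flip w, \<not> e)"
proof (cases e)
  case True
  have "feq (alpha (flip (alpha w)) @ [(0, True)]) (((0, True) # flip w @ [(0, False)]) @ [(0, True)])"
    by (intro pres_eq_append alpha_flip_alpha pres_eq.pe_refl)
  also have "feq ... ((0, True) # flip w)"
    using pres_eq.pe_cancel[of "{}" "(0, True) # flip w" "(0, False)" "[]"] by (simp add: inv_letter_def)
  finally show ?thesis
    using True by (simp add: state_eq_def alpha_letter_def alpha_gen_def flip_letter_def inv_letter_def)
next
  case False
  have "feq (alpha (flip (alpha w)) @ [(0, True)]) (((0, True) # flip w @ [(0, False)]) @ [(0, True)])"
    by (intro pres_eq_append alpha_flip_alpha pres_eq.pe_refl)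
  also have "feq ... ((0, True) # flip w)"
    using pres_eq.pe_cancel[of "{}" "(0, True) # flip w" "(0, False)" "[]"] by (simp add: inv_letter_def)
  finally show ?thesis
    using False by (simp add: state_eq_def)
qed

lemma acts_b1: "state_eq (acts (b_conj 1) (w, e)) ((1, True) # flip w, \<not> e)"
proof -
  have "acts (b_conj 1) (w, e) = act Gd (acts (b_conj 0) (swap w, e))" by simp
  also have "state_eq (act Gd (acts (b_conj 0) (swap w, e))) (act Gd ((0, True) # flip (swap w), \<not> e))"
    by (intro act_cong acts_b0)
  also have "act Gd ((0, True) # flip (swap w), \<not> e) = ((1, True) # flip w, \<not> e)"
    by (simp add: flip_swap) (simp add: swap_letter_def)
  finally show ?thesis .
qed

lemma acts_b2: "state_eq (acts (b_conj 2) (w, e)) ((2, True) # flip w, \<not> e)"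
proof -
  have "acts (b_conj 2) (w, e) = act Ga (acts (b_conj 1) (act Ga (w, e)))" by simp
  also have "state_eq (act Ga (acts (b_conj 1) (act Ga (w, e))))
      (act Ga ((1, True) # flip (fst (act Ga (w, e))), \<not> e))"
    using acts_b1[of "fst (act Ga (w, e))" e] by (intro act_cong) simp
  also have "state_eq (act Ga ((1, True) # flip (fst (act Ga (w, e))), \<not> e)) ((2, True) # flip w, \<not> e)"
  proof -
    have "feq ([(2, True), (0, False)] @ alpha (flip (alpha w)) @ [(0, True)])
      ([(2, True), (0, False)] @ ((0, True) # flip w @ [(0, False)]) @ [(0, True)])"
      by (intro pres_eq_append alpha_flip_alpha pres_eq.pe_refl)
    also have "feq ... ([(2, True), (0, False)] @ ((0, True) # flip w))"
      using pres_eq.pe_cancel[of "{}" "[(2, True), (0, False)] @ (0, True) # flip w" "(0, False)" "[]"] by (simp add: inv_letter_def)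
    also have "feq ... ((2, True) # flip w)"
      using pres_eq.pe_cancel[of "{}" "[(2, True)]" "(0, False)" "flip w"] by (simp add: inv_letter_def)
    finally show ?thesis
      by (cases e) (simp_all add: state_eq_def alpha_letter_def alpha_gen_def flip_letter_def inv_letter_def)
  qed
  finally show ?thesis .
qed

text \<open>The element b b_i acts by left translation because the two flips cancel; this is what
  makes \<open>iota\<close> injective.\<close>

lemma acts_iota: "rank3 y \<Longrightarrow> state_eq (acts (iota y) (w, e)) (y @ w, e)"
proof (induction y)
  case (Cons x y)
  then have "rank3 y" by (cases x) auto
  obtain i s where x: "x = (i, s)" and i: "i = 0 \<or> i = 1 \<or> i = 2" using Cons.prems by (cases x) auto
  have b: "state_eq (acts (b_conj i) (w, e)) ((i, True) # flip w, \<not> e)" for w e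
    using i acts_b0 acts_b1 acts_b2 by blast
  have "state_eq (acts (iota_letter x) (y @ w, e)) (x # y @ w, e)"
  proof (cases s)
    case True
    then show ?thesis using b[of "flip (y @ w)" "\<not> e"] by (simp add: x iota_letter_def del: b_conj.simps)
  next
    case False
    then show ?thesis using act_cong[OF b[of "y @ w" e], of Gb]
      by (simp add: x iota_letter_def flip_letter_def inv_letter_def del: b_conj.simps)
  qed
  moreover have "state_eq (acts (iota (x # y)) (w, e)) (acts (iota_letter x) (y @ w, e))"
    using acts_cong Cons \<open>rank3 y\<close> by simp
  ultimately show ?case using state_eq_trans by fastforce
qed simp

lemma iota_feq: "feq x y \<Longrightarrow> weq n (iota x) (iota y)"
proof (induction rule: pres_eq.induct)
  case (pe_cancel x l y)
  have "iota_letter (inv_letter l) = rev (iota_letter l)"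
    by (auto simp: iota_letter_def inv_letter_def)
  then have "weq n (iota x @ (iota_letter l @ iota_letter (inv_letter l)) @ iota y) (iota x @ [] @ iota y)"
    by (intro weq_append weq.refl) (simp add: weq_rev_right)
  then show ?case by simp
qed (auto intro: weq.intros)

lemma iota_conj:
  assumes "rank3 w"
    and l: "\<And>x w. rank3 (x # w) \<Longrightarrow> weq 0 (g # iota_letter x) (iota (h x) @ [g])"
  shows "weq 0 (g # iota w) (iota (subst_word h w) @ [g])"
  using assms(1)
proof (induction w)
  case (Cons x w)
  have "rank3 w" using Cons.prems by (cases x) auto
  have "weq 0 ((g # iota_letter x) @ iota w) ((iota (h x) @ [g]) @ iota w)"
    by (intro weq_append weq.refl l[OF Cons.prems])
  also have "weq 0 ... (iota (h x) @ (iota (subst_word h w) @ [g]))"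
    using weq_app_left[OF Cons.IH[OF \<open>rank3 w\<close>], of "iota (h x)"] by simp
  finally show ?case by simp
qed simp

lemma iota_flip: "rank3 w \<Longrightarrow> weq 0 (Gb # iota w) (iota (flip w) @ [Gb])"
proof (erule iota_conj)
  fix x :: "nat \<times> bool" and w assume "rank3 (x # w)"
  then show "weq 0 (Gb # iota_letter x) (iota (flip_letter x) @ [Gb])"
    by (cases x rule: rank3_letter_cases; intro weq_if_nf_eq; simp add: flip_letter_def iota_letter_def inv_letter_def)
qed

lemma iota_alpha: "rank3 w \<Longrightarrow> weq 0 (Ga # iota w) (iota (alpha w) @ [Ga])"
proof (erule iota_conj)
  fix x :: "nat \<times> bool" and w assume "rank3 (x # w)"
  then show "weq 0 (Ga # iota_letter x) (iota (alpha_letter x) @ [Ga])"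
    by (cases x rule: rank3_letter_cases; intro weq_if_nf_eq; simp add: alpha_letter_def alpha_gen_def iota_letter_def inv_letter_def)
qed

text \<open>b_2 is the conjugate of b by ada, and d commutes with b and, by (ad)^4 = 1, with
  ada.\<close>

lemma d_b2: "weq 0 (Gd # b_conj 2) (b_conj 2 @ [Gd])"
proof -
  have "weq 0 ([Gd,Ga,Gd,Ga] @ [Gb,Ga,Gd,Ga]) ([Ga,Gd,Ga,Gd] @ [Gb,Ga,Gd,Ga])"
    by (intro weq_append weq.refl weq.sym[OF adad_comm])
  also have "weq 0 ... ([Ga,Gd,Ga,Gb] @ [Gd,Ga,Gd,Ga])" by (rule weq_if_nf_eq) simp
  also have "weq 0 ... ([Ga,Gd,Ga,Gb] @ [Ga,Gd,Ga,Gd])"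
    by (intro weq_append weq.refl weq.sym[OF adad_comm])
  finally show ?thesis by simp
qed

lemma iota_swap: "rank3 w \<Longrightarrow> weq 0 (Gd # iota w) (iota (swap w) @ [Gd])"
proof (erule iota_conj)
  fix x :: "nat \<times> bool" and w assume "rank3 (x # w)"
  then show "weq 0 (Gd # iota_letter x) (iota (swap_letter x) @ [Gd])"
  proof (cases x rule: rank3_letter_cases)
    \<comment> \<open>d exchanges b_0 and b_1 by the base relators alone; that it fixes b_2 rests on
      (ad)^4, hence the separate treatment of the letter 2.\<close>
    case 5
    have "weq 0 ((Gd # b_conj 2) @ [Gb]) ((b_conj 2 @ [Gd]) @ [Gb])" by (intro weq_append weq.refl d_b2)
    also have "weq 0 ... (b_conj 2 @ [Gb, Gd])"
      using weq_app_left[of 0 "[Gd, Gb]" "[Gb, Gd]" "b_conj 2"] by (simp add: weq_if_nf_eq)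
    finally show ?thesis using 5 by (simp add: swap_letter_def iota_letter_def)
  next
    case 6
    have "weq 0 ([Gd, Gb] @ b_conj 2) ([Gb, Gd] @ b_conj 2)" 
      by (intro weq_append weq.refl) (simp add: weq_if_nf_eq)
    also have "weq 0 ... ([Gb] @ (b_conj 2 @ [Gd]))"
      using weq_app_left[OF d_b2, of "[Gb]"] by simp
    finally show ?thesis using 6 by (simp add: swap_letter_def iota_letter_def)
  qed (intro weq_if_nf_eq; simp add: swap_letter_def iota_letter_def)+
qed

section \<open>The semidirect decomposition of \<open>G_0\<close>\<close>

definition theta :: "gen list \<Rightarrow> state" where "theta w = acts w ([], False)"

definition bpow :: "bool \<Rightarrow> gen list" where "bpow e = (if e then [Gb] else [])"

lemma rank3_theta: "rank3 (fst (theta w))"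
  by (simp add: theta_def rank3_acts)

lemma snd_theta: "snd (theta w) = bc w"
proof (induction w)
  case (Cons x w) then show ?case by (cases x; cases "theta w") (auto simp: theta_def)
qed (simp add: theta_def)

definition bpart :: "state \<Rightarrow> gen list" where "bpart s = iota (fst s) @ bpow (snd s)"

lemma bpart_act:
  assumes "rank3 (fst s)"
  shows "weq 0 (Ga # bpart s) (bpart (act Ga s) @ [Ga])" "weq 0 (Gb # bpart s) (bpart (act Gb s))"
   "weq 0 (Gd # bpart s) (bpart (act Gd s) @ [Gd])"
proof -
  obtain w e where s: "s = (w, e)" by (cases s)
  have w: "rank3 w" using assms s by simp
  show "weq 0 (Ga # bpart s) (bpart (act Ga s) @ [Ga])"
  proof -
    have "weq 0 ((Ga # iota w) @ bpow e) ((iota (alpha w) @ [Ga]) @ bpow e)"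
      by (intro weq_append weq.refl iota_alpha w)
    also have "weq 0 ... (iota (alpha w) @ (if e then iota [(0, True)] else []) @ bpow e @ [Ga])"
      using weq_app_left[of 0 "[Ga] @ bpow e" "(if e then iota [(0, True)] else []) @ bpow e @ [Ga]"]
      by (auto simp: bpow_def iota_letter_def weq_if_nf_eq)
    finally show ?thesis by (auto simp: s bpart_def)
  qed
  show "weq 0 (Gb # bpart s) (bpart (act Gb s))"
  proof -
    have "weq 0 ((Gb # iota w) @ bpow e) ((iota (flip w) @ [Gb]) @ bpow e)"
      by (intro weq_append weq.refl iota_flip w)
    also have "weq 0 ... (iota (flip w) @ bpow (\<not> e))"
      using weq_app_left[of 0 "[Gb] @ bpow e" "bpow (\<not> e)"]
      by (auto simp: bpow_def weq_if_nf_eq)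
    finally show ?thesis by (auto simp: s bpart_def)
  qed
  show "weq 0 (Gd # bpart s) (bpart (act Gd s) @ [Gd])"
  proof -
    have "weq 0 ((Gd # iota w) @ bpow e) ((iota (swap w) @ [Gd]) @ bpow e)"
      by (intro weq_append weq.refl iota_swap w)
    also have "weq 0 ... (iota (swap w) @ bpow e @ [Gd])"
      using weq_app_left[of 0 "[Gd] @ bpow e" "bpow e @ [Gd]"]
      by (auto simp: bpow_def weq_if_nf_eq)
    finally show ?thesis by (auto simp: s bpart_def)
  qed
qed

text \<open>By prepending letters: the part in B changes by \<open>act\<close>, and a letter a or d
  moves on into the dihedral part. So an element of \<open>G_0\<close> is determined by
  \<open>theta\<close> and its dihedral image.\<close>

lemma weq_bpart_dihedral_part: "weq 0 w (bpart (theta w) @ dihedral_part w)"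
proof (induction w)
  case Nil
  show ?case by (simp add: theta_def bpart_def bpow_def dihedral_part_def dihedral_word_def)
next
  case (Cons x w)
  have th: "theta (x # w) = act x (theta w)" by (simp add: theta_def)
  note B = bpart_act[OF rank3_theta[of w]]
  have "weq 0 (x # w) (x # bpart (theta w) @ dihedral_part w)" by (rule weq_Cons[OF Cons])
  also have "weq 0 ... (bpart (theta (x # w)) @ dihedral_part (x # w))"
  proof (cases x)
    case Ga
    have "weq 0 ((Ga # bpart (theta w)) @ dihedral_part w) ((bpart (act Ga (theta w)) @ [Ga]) @ dihedral_part w)"
      by (intro weq_append B weq.refl)
    also have "weq 0 ... (bpart (act Ga (theta w)) @ dihedral_part (Ga # w))"
      using weq_app_left[OF dihedral_part_Cons(1)] by simp
    finally show ?thesis using Ga th by simp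
  next
    case Gb
    have "weq 0 ((Gb # bpart (theta w)) @ dihedral_part w) (bpart (act Gb (theta w)) @ dihedral_part w)"
      by (intro weq_append B weq.refl)
    then show ?thesis using Gb th dihedral_part_Cons(2) by simp
  next
    case Gd
    have "weq 0 ((Gd # bpart (theta w)) @ dihedral_part w) ((bpart (act Gd (theta w)) @ [Gd]) @ dihedral_part w)"
      by (intro weq_append B weq.refl)
    also have "weq 0 ... (bpart (act Gd (theta w)) @ dihedral_part (Gd # w))"
      using weq_app_left[OF dihedral_part_Cons(4)] by simp
    finally show ?thesis using Gd th by simp
  next
    case Gc
    \<comment> \<open>c is treated as bd: d moves on into the dihedral part, b stays in the part in
      B.\<close>
    have a: "act Gc (theta w) = act Gb (act Gd (theta w))" by (cases "theta w") simp
    have o: "rank3 (fst (act Gd (theta w)))" using rank3_acts[OF rank3_theta[of w], of "[Gd]"] by simp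
    have "weq 0 ([Gc] @ (bpart (theta w) @ dihedral_part w)) ([Gb, Gd] @ (bpart (theta w) @ dihedral_part w))"
      by (intro weq_append weq.refl) (simp add: weq_if_nf_eq)
    also have "weq 0 ... ([Gb] @ (bpart (act Gd (theta w)) @ [Gd]) @ dihedral_part w)"
      using weq_app_left[OF weq_app_right[OF B(3)], of "[Gb]" "dihedral_part w"] by simp
    also have "weq 0 ... ((Gb # bpart (act Gd (theta w))) @ dihedral_part (Gc # w))"
      using weq_app_left[OF dihedral_part_Cons(3)[of w], of "Gb # bpart (act Gd (theta w))"] by simp
    also have "weq 0 ... (bpart (act Gb (act Gd (theta w))) @ dihedral_part (Gc # w))"
      by (intro weq_append weq.refl bpart_act(2) o)
    finally show ?thesis using Gc th a by simp
  qed
  finally show ?case .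
qed

section \<open>Decomposition of \<open>G_(n+1)\<close> and injectivity of the wreath
  recursion\<close>

lemma weq_mid: "weq n x y \<Longrightarrow> weq n (p @ x @ q) (p @ y @ q)"
  by (intro weq_append weq.refl)

text \<open>Its sections are x and \<open>sec0_sigma x\<close>; when x has trivial dihedral image,
  this is the element (x, 1).\<close>

definition conj_sigma :: "gen list \<Rightarrow> gen list" where "conj_sigma x = [Ga] @ sigma_list x @ [Ga]"

lemma conj_sigma_append: "weq n (conj_sigma (x @ y)) (conj_sigma x @ conj_sigma y)"
  using weq_mid[OF weq_double[of n Ga "[]"], of "[Ga] @ sigma_list x" "sigma_list y @ [Ga]"] weq.sym
  by (simp add: conj_sigma_def)

lemma conj_sigma_weq: "weq n x y \<Longrightarrow> weq (Suc n) (conj_sigma x) (conj_sigma y)"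
  unfolding conj_sigma_def by (intro weq_append weq.refl sigma_list_weq)

definition commutes_d :: "gen list \<Rightarrow> bool" where
  "commutes_d y \<longleftrightarrow> weq 1 (Gd # conj_sigma y) (conj_sigma y @ [Gd])"

lemma commutes_d_append: assumes "commutes_d x" "commutes_d y" shows "commutes_d (x @ y)"
proof -
  have "weq 1 ([Gd] @ conj_sigma (x @ y)) ([Gd] @ (conj_sigma x @ conj_sigma y))"
    by (intro weq_append weq.refl conj_sigma_append)
  also have "weq 1 ... ((conj_sigma x @ [Gd]) @ conj_sigma y)"
    using weq_app_right[OF assms(1)[unfolded commutes_d_def], of "conj_sigma y"] by simp
  also have "weq 1 ... (conj_sigma x @ (conj_sigma y @ [Gd]))"
    using weq_app_left[OF assms(2)[unfolded commutes_d_def], of "conj_sigma x"] by simp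
  also have "weq 1 ... (conj_sigma (x @ y) @ [Gd])"
    using weq_app_right[OF weq.sym[OF conj_sigma_append[of 1 x y]], of "[Gd]"] by simp
  finally show ?thesis by (simp add: commutes_d_def)
qed

lemma commutes_d_Nil: "commutes_d []"
  by (simp add: commutes_d_def conj_sigma_def weq_if_nf_eq)

lemma rel1: "u_list 0 \<in> rel_list (Suc 0)" "v_list 0 \<in> rel_list (Suc 0)"
  by (auto simp: rel_list_def)

lemma commutes_d_rel:
  assumes "r \<in> rel_list 1" "nf (Gd # conj_sigma y) = nf (p @ r @ rev p @ conj_sigma y @ [Gd])"
  shows "commutes_d y"
proof -
  have "weq 1 (Gd # conj_sigma y) (p @ rev p @ conj_sigma y @ [Gd])"
    by (rule weq_if_rel[OF assms(1,2)]) simp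
  also have "weq 1 ... (conj_sigma y @ [Gd])"
    using weq_app_right[OF weq_rev_right[of 1 p], of "conj_sigma y @ [Gd]"] by simp
  finally show ?thesis by (simp add: commutes_d_def)
qed

text \<open>\<open>conj_sigma\<close> gives the conjugates of d by a, ca, acaca and cacaca. Their
  commutators with d are conjugates of (ad)^4 in the first two cases and of \<open>v_list 0\<close>
  in the last two, by the list given to \<open>commutes_d_rel\<close>. The index is 1 because
  \<open>G_1\<close> is the first group to have \<open>v_list 0\<close> as a relator.\<close>

lemma commutes_d_gens: "commutes_d [Gb]" "commutes_d (b_conj 0)" "commutes_d (b_conj 1)" "commutes_d (b_conj 2)"
proof -
  note s = u_list_def v_list_def fourth_def conj_sigma_def
  show "commutes_d [Gb]" by (rule commutes_d_rel[of "u_list 0" _ "[Gd]"], simp add: rel1, simp add: s)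
  show "commutes_d (b_conj 0)" by (rule commutes_d_rel[of "u_list 0" _ "[Gb]"], simp add: rel1, simp add: s)
  show "commutes_d (b_conj 1)" by (rule commutes_d_rel[of "v_list 0" _ "[Ga]"], simp add: rel1, simp add: s)
  show "commutes_d (b_conj 2)" by (rule commutes_d_rel[of "v_list 0" _ "[Gc, Ga]"], simp add: rel1, simp add: s)
qed

lemma commutes_d_iota: "rank3 w \<Longrightarrow> commutes_d (iota w)"
proof (induction w)
  case (Cons x w)
  then have "rank3 w" by (cases x) auto
  from Cons.prems have "commutes_d (iota_letter x)"
    using commutes_d_gens commutes_d_append[of "[Gb]"] commutes_d_append[of _ "[Gb]"]
    by (cases x rule: rank3_letter_cases) (auto simp: iota_letter_def simp del: b_conj.simps)
  with Cons.IH[OF \<open>rank3 w\<close>] show ?case by (simp add: commutes_d_append)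
qed (simp add: commutes_d_Nil)

abbreviation dihedral_one :: "bool list" where "dihedral_one \<equiv> [False, False, False]"

text \<open>Trivial dihedral image makes x, already in \<open>G_0\<close>, a product of conjugates
  of b by <a, d>; \<open>conj_sigma\<close> carries this equality to \<open>G_1\<close>.\<close>

lemma d_conj_sigma_comm:
  assumes "dihedral x = dihedral_one" shows "weq (Suc n) (Gd # conj_sigma x) (conj_sigma x @ [Gd])"
proof -
  have x: "weq 0 x (bpart (theta x))"
    using weq_bpart_dihedral_part[of x] dihedral_part_trivial[OF assms] by simp
  have t: "weq 1 (conj_sigma x) (conj_sigma (bpart (theta x)))" using conj_sigma_weq[OF x] by simp
  have c: "commutes_d (bpart (theta x))"
    using commutes_d_iota[OF rank3_theta[of x]] commutes_d_gens(1) commutes_d_Nil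
    by (auto simp: bpart_def bpow_def intro!: commutes_d_append)
  have "weq 1 ([Gd] @ conj_sigma x) ([Gd] @ conj_sigma (bpart (theta x)))" by (intro weq_append weq.refl t)
  also have "weq 1 ... (conj_sigma (bpart (theta x)) @ [Gd])" using c by (simp add: commutes_d_def)
  also have "weq 1 ... (conj_sigma x @ [Gd])" by (intro weq_append weq.refl weq.sym[OF t])
  finally show ?thesis by (simp add: weq_mono[of 1])
qed

lemma dihedral_conj: assumes "dihedral x = dihedral_one" shows "dihedral (z @ x @ rev z) = dihedral_one"
proof -
  have "dihedral (x @ rev z) = dihedral (rev z)" using dihedral_left[of x "[]" "rev z"] assms by simp
  then have "dihedral (z @ x @ rev z) = dihedral (z @ rev z)" by (rule dihedral_right)
  then show ?thesis using dihedral_weq[OF weq_rev_right[of 0 z]] by simp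
qed

lemma dihedral_append_dihedral_one: "dihedral x = dihedral_one \<Longrightarrow> dihedral y = dihedral_one \<Longrightarrow> dihedral (x @ y) = dihedral_one"
  using dihedral_left[of x "[]" y] by simp

text \<open>In coordinates, conjugation by \<sigma>(g) takes (x, 1) to (f(g) x f(g)^{-1}, 1) with f
  = \<open>sec0_sigma\<close>. For b this is commutation with d, for a and d it uses the base
  relators, and \<sigma>(c) = b = cd combines both.\<close>

lemma sigma_letter_conj_sigma:
  assumes "dihedral x = dihedral_one"
  shows "weq (Suc n) (sigma_letter g @ conj_sigma x) (conj_sigma (sec0_sigma_letter g @ x @ rev (sec0_sigma_letter g)) @ sigma_letter g)"
proof -
  have D: "weq (Suc n) ([Gc] @ conj_sigma x) (conj_sigma ([Ga] @ x @ [Ga]) @ [Gc])"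
    using weq_mid[OF weq_if_nf_eq[of "[Gc, Ga]" "[Ga,Ga,Gc,Ga]" "Suc n"], of "[]" "sigma_list x @ [Ga]"]
      weq_app_left[OF weq_if_nf_eq[of "[Ga]" "[Ga,Gc,Ga,Ga,Gc]" "Suc n"], of "[Ga,Ga,Gc,Ga] @ sigma_list x"]
    by (simp add: conj_sigma_def) (meson weq.trans)
  show ?thesis
  proof (cases g)
    case Ga
    have "weq (Suc n) ([Ga,Gc,Ga,Ga] @ sigma_list x @ [Ga]) ([Ga,Gc] @ sigma_list x @ [Ga])"
      by (intro weq_append weq.refl) (simp add: weq_if_nf_eq)
    also have "weq (Suc n) ([Ga,Gc] @ sigma_list x @ [Ga]) ([Ga,Gc] @ sigma_list x @ [Gc,Ga,Ga,Gc,Ga])"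
      by (intro weq_append weq.refl) (simp add: weq_if_nf_eq)
    finally show ?thesis using Ga by (simp add: conj_sigma_def)
  next
    case Gb then show ?thesis using d_conj_sigma_comm[OF assms] by simp
  next
    case Gd then show ?thesis using D by simp
  next
    case Gc
    have "weq (Suc n) ([Gb] @ conj_sigma x) ([Gc, Gd] @ conj_sigma x)"
      by (intro weq_append weq.refl) (simp add: weq_if_nf_eq)
    also have "weq (Suc n) ... ([Gc] @ (conj_sigma x @ [Gd]))"
      using weq_app_left[OF d_conj_sigma_comm[OF assms], of n "[Gc]"] by simp
    also have "weq (Suc n) ... ((conj_sigma ([Ga] @ x @ [Ga]) @ [Gc]) @ [Gd])"
      using weq_app_right[OF D, of "[Gd]"] by simp
    also have "weq (Suc n) ... (conj_sigma ([Ga] @ x @ [Ga]) @ [Gb])"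
      using weq_app_left[OF weq_if_nf_eq[of "[Gc, Gd]" "[Gb]"]] by simp
    finally show ?thesis using Gc by simp
  qed
qed

lemma sigma_list_conj_sigma:
  assumes "dihedral x = dihedral_one"
  shows "weq (Suc n) (sigma_list y @ conj_sigma x) (conj_sigma (sec0_sigma y @ x @ rev (sec0_sigma y)) @ sigma_list y)"
proof (induction y)
  case (Cons g y)
  have "weq (Suc n) (sigma_list (g # y) @ conj_sigma x) (sigma_letter g @ conj_sigma (sec0_sigma y @ x @ rev (sec0_sigma y)) @ sigma_list y)"
    using weq_app_left[OF Cons, of "sigma_letter g"] by simp
  also have "weq (Suc n) ... (conj_sigma (sec0_sigma (g # y) @ x @ rev (sec0_sigma (g # y))) @ sigma_list (g # y))"
    using weq_app_right[OF sigma_letter_conj_sigma[OF dihedral_conj[OF assms, of "sec0_sigma y"]], of n g "sigma_list y"] by simp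
  finally show ?case .
qed simp

text \<open>By appending letters. After an even word, b, c, d are \<sigma>(c), \<sigma>(d),
  \<sigma>(b). After an odd one, ag = (aga)a with aca = \<sigma>(a), ada = a \<sigma>(b) a and aba =
  (ada)(aca); the factor ada is moved left past \<sigma>(y).\<close>

lemma decomp:
  "\<exists>x y. dihedral x = dihedral_one \<and> weq (Suc n) w (conj_sigma x @ sigma_list y @ (if par w then [Ga] else []))"
proof (induction w rule: rev_induct)
  case Nil
  have "weq (Suc n) [] (conj_sigma [] @ sigma_list [])" by (simp add: conj_sigma_def weq_if_nf_eq)
  then show ?case by (intro exI[of _ "[]"]) simp
next
  case (snoc g w)
  then obtain x y where x: "dihedral x = dihedral_one" and w: "weq (Suc n) w (conj_sigma x @ sigma_list y @ (if par w then [Ga] else []))"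
    by blast
  define z where "z = sec0_sigma y @ [Gb] @ rev (sec0_sigma y)"
  have z: "dihedral z = dihedral_one" unfolding z_def by (rule dihedral_conj) (simp add: dihedral_def)
  have zz: "weq (Suc n) (conj_sigma x @ sigma_list y @ [Ga,Gd,Ga] @ q) (conj_sigma (x @ z) @ sigma_list y @ q)" for q
  proof -
    have "weq (Suc n) (conj_sigma x @ (sigma_list y @ conj_sigma [Gb]) @ q) (conj_sigma x @ (conj_sigma z @ sigma_list y) @ q)"
      unfolding z_def by (intro weq_append weq.refl sigma_list_conj_sigma) (simp add: dihedral_def)
    also have "weq (Suc n) ... (conj_sigma (x @ z) @ sigma_list y @ q)"
      using weq_app_right[OF weq.sym[OF conj_sigma_append[of "Suc n" x z]], of "sigma_list y @ q"] by simp
    finally show ?thesis by (simp add: conj_sigma_def)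
  qed
  have xz: "dihedral (x @ z) = dihedral_one" by (intro dihedral_append_dihedral_one x z)
  have wg: "weq (Suc n) (w @ [g]) (conj_sigma x @ sigma_list y @ (if par w then [Ga] else []) @ [g])"
    using weq_app_right[OF w, of "[g]"] by simp
  show ?case
  proof (cases "par w")
    case False
    show ?thesis
    proof (cases g)
      case Ga
      then show ?thesis using wg x False by (intro exI[of _ x] exI[of _ y]) simp
    next
      case Gb
      then show ?thesis using wg x False by (intro exI[of _ x] exI[of _ "y @ [Gc]"]) simp
    next
      case Gc
      then show ?thesis using wg x False by (intro exI[of _ x] exI[of _ "y @ [Gd]"]) simp
    next
      case Gd
      then show ?thesis using wg x False by (intro exI[of _ x] exI[of _ "y @ [Gb]"]) simp
    qed
  next
    case True
    have move: "weq (Suc n) (w @ [g]) (conj_sigma x @ sigma_list y @ q)" if "nf [Ga, g] = nf q" for q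
      using weq.trans[OF wg] weq_app_left[OF weq_if_nf_eq[OF that], of "Suc n" "conj_sigma x @ sigma_list y"] True by simp
    show ?thesis
    proof (cases g)
      case Ga
      then show ?thesis using move[of "[]"] x True by (intro exI[of _ x] exI[of _ y]) simp
    next
      case Gb
      then show ?thesis using weq.trans[OF move zz, of "[Ga,Gc,Ga,Ga]"] xz True
        by (intro exI[of _ "x @ z"] exI[of _ "y @ [Ga]"]) simp
    next
      case Gc
      then show ?thesis using move[of "[Ga,Gc,Ga,Ga]"] x True by (intro exI[of _ x] exI[of _ "y @ [Ga]"]) simp
    next
      case Gd
      then show ?thesis using weq.trans[OF move zz, of "[Ga]"] xz True
        by (intro exI[of _ "x @ z"] exI[of _ "y"]) simp
    qed
  qed
qed

lemma sec_conj_sigma_sigma_list: "sec False (conj_sigma x @ sigma_list y) = x @ sec0_sigma y" "sec True (conj_sigma x @ sigma_list y) = sec0_sigma x @ y"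
  by (simp_all add: conj_sigma_def)

text \<open>As \<open>sec0_sigma x\<close> is trivial, the second section gives y = 1; then
  \<open>sec0_sigma y\<close> is trivial and the first section gives x = 1.\<close>

lemma weq_Nil_if_sec:
  assumes "\<not> par w" "\<And>i. weq n (sec i w) []"
  shows "weq (Suc n) w []"
proof -
  obtain x y where x: "dihedral x = dihedral_one" and w: "weq (Suc n) w (conj_sigma x @ sigma_list y)"
    using decomp[of n w] assms(1) by auto
  have "weq n (sec0_sigma x @ y) []"
    using sec_weq[OF w, of True] assms(2)[of True] by (metis sec_conj_sigma_sigma_list(2) weq.sym weq.trans)
  moreover have "weq n (sec0_sigma x @ y) y" using weq_app_right[OF sec0_sigma_trivial[OF x, of n], of y] by simp
  ultimately have y: "weq n y []" by (meson weq.sym weq.trans)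
  then have fy: "weq n (sec0_sigma y) []" using dihedral_weq[OF y] sec0_sigma_trivial by simp
  have "weq n (x @ sec0_sigma y) []"
    using sec_weq[OF w, of False] assms(2)[of False] by (metis sec_conj_sigma_sigma_list(1) weq.sym weq.trans)
  moreover have "weq n (x @ sec0_sigma y) x" using weq_app_left[OF fy, of x] by simp
  ultimately have "weq n x []" by (meson weq.sym weq.trans)
  then have "weq (Suc n) (conj_sigma x) (conj_sigma [])" by (rule conj_sigma_weq)
  also have "weq (Suc n) (conj_sigma []) []" by (simp add: conj_sigma_def weq_if_nf_eq)
  finally have "weq (Suc n) (conj_sigma x @ sigma_list y) ([] @ sigma_list [])" by (intro weq_append sigma_list_weq y)
  with w show ?thesis by (simp, meson weq.trans)
qed

section \<open>The finite quotients by \<open>H_n\<close>\<close>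

fun level_quot :: "nat \<Rightarrow> gen list \<Rightarrow> bool list" where
  "level_quot 0 w = quot16 w"
| "level_quot (Suc n) w = par w # level_quot n (sec False w) @ level_quot n (sec True w)"

lemma length_level_quot: "length (level_quot n w) = 5 * 2 ^ n - 1"
proof (induction n arbitrary: w)
  case (Suc n)
  obtain k where "(2::nat) ^ n = Suc k" by (metis not0_implies_Suc power_not_zero zero_neq_numeral)
  then show ?case by (simp add: Suc)
qed (simp add: quot16_def)

text \<open>All values have the same length, so the concatenation splits uniquely.\<close>

lemma level_quot_Suc_eq: "level_quot (Suc n) x = level_quot (Suc n) y \<longleftrightarrow>
    par x = par y \<and> level_quot n (sec False x) = level_quot n (sec False y) \<and> level_quot n (sec True x) = level_quot n (sec True y)"
  using length_level_quot[of n "sec False x"] length_level_quot[of n "sec False y"] by auto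

declare level_quot.simps(2) [simp del]

lemma level_quot_append: "level_quot n x = level_quot n x' \<Longrightarrow> level_quot n y = level_quot n y' \<Longrightarrow> level_quot n (x @ y) = level_quot n (x' @ y')"
proof (induction n arbitrary: x x' y y')
  case 0 then show ?case using quot16_left[of x x' y] quot16_right[of y y' x'] by simp
next
  case (Suc n)
  have "level_quot n (sec i (x @ y)) = level_quot n (sec i (x' @ y'))" for i
    using Suc.prems unfolding sec_append level_quot_Suc_eq by (intro Suc.IH; cases i; cases "par x") simp_all
  then show ?case using Suc.prems by (simp add: level_quot_Suc_eq del: sec_append)
qed

lemma level_quot_weq: "weq n x y \<Longrightarrow> level_quot n x = level_quot n y"
proof (induction n arbitrary: x y)
  case 0 then show ?case using quot16_weq[of 0 x y] by simp
next
  case (Suc n)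
  show ?case unfolding level_quot_Suc_eq
    by (intro conjI Suc.IH sec_weq[OF Suc.prems] par_weq[OF Suc.prems])
qed

lemma quot16_if_level_quot: "level_quot n x = level_quot n y \<Longrightarrow> quot16 x = quot16 y"
proof (induction n arbitrary: x y)
  case (Suc n)
  from Suc.prems have *: "par x = par y" "level_quot n (sec False x) = level_quot n (sec False y)"
    "level_quot n (sec True x) = level_quot n (sec True y)" unfolding level_quot_Suc_eq by blast+
  show ?case by (rule quot16_sec[OF *(1) Suc.IH[OF *(2)] Suc.IH[OF *(3)]])
qed simp

lemma dihedral_if_level_quot: "level_quot n x = level_quot n y \<Longrightarrow> dihedral x = dihedral y"
  using quot16_if_level_quot[of n x y] by (simp add: quot16_dihedral)

text \<open>In group terms, \<open>H_(n+1)\<close> is the preimage of \<open>H_n\<close> x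
  \<open>H_n\<close> under the wreath recursion.\<close>

lemma level_quot_Suc_Nil: "level_quot (Suc n) w = level_quot (Suc n) [] \<longleftrightarrow> \<not> par w \<and> (\<forall>i. level_quot n (sec i w) = level_quot n [])"
  unfolding level_quot_Suc_eq all_bool_eq by auto

subsection \<open>The index\<close>

lemma finite_level_quot: "finite (range (level_quot n))"
proof (rule finite_subset)
  show "range (level_quot n) \<subseteq> {xs. set xs \<subseteq> UNIV \<and> length xs = 5 * 2 ^ n - 1}" using length_level_quot by auto
  show "finite {xs :: bool list. set xs \<subseteq> UNIV \<and> length xs = 5 * 2 ^ n - 1}"
    by (rule finite_lists_length_eq) simp
qed

definition fiber :: "nat \<Rightarrow> bool list \<Rightarrow> bool list set" where
  "fiber n g = level_quot n ` {w. dihedral w = g}"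

lemma finite_fiber: "finite (fiber n g)"
  unfolding fiber_def by (rule finite_subset[OF _ finite_level_quot[of n]]) blast

lemma dihedral_dihedral_word: "dihedral (dihedral_word p e f) = [p, e, f]"
  by (cases p; cases e; cases f) (simp_all add: dihedral_word_def dihedral_def)

lemma ex_dihedral: "length g = 3 \<Longrightarrow> \<exists>r. dihedral r = g"
  by (auto simp: length_Suc_conv numeral_eq_Suc intro: dihedral_dihedral_word)

text \<open>Right multiplication by a word r with dihedral image g carries one fibre onto the
  other.\<close>

lemma card_fiber:
  assumes "length g = 3" shows "card (fiber n g) = card (fiber n dihedral_one)"
proof -
  obtain r where r: "dihedral r = g" using ex_dihedral[OF assms] by blast
  \<comment> \<open>The product is formed on a chosen word; by \<open>level_quot_append\<close> the
    choice does not matter.\<close>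
  define h where "h y = level_quot n ((SOME w. level_quot n w = y) @ r)" for y
  have h: "h (level_quot n w) = level_quot n (w @ r)" for w
    unfolding h_def by (rule level_quot_append) (rule someI[of _ w], simp_all)
  have canc: "level_quot n ((w @ r) @ rev r) = level_quot n w" for w
    using level_quot_append[OF _ level_quot_weq[OF weq_rev_right[of n r]], of w w] by simp
  have canc': "level_quot n ((w @ rev r) @ r) = level_quot n w" for w
    using level_quot_append[OF _ level_quot_weq[OF weq_rev_left[of n r]], of w w] by simp
  have "inj_on h (fiber n dihedral_one)"
  proof (rule inj_onI)
    fix x y assume "x \<in> fiber n dihedral_one" "y \<in> fiber n dihedral_one" and e: "h x = h y"
    then obtain w w' where w: "x = level_quot n w" "y = level_quot n w'" unfolding fiber_def by blast
    with e have "level_quot n (w @ r) = level_quot n (w' @ r)" unfolding w h by blast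
    then have "level_quot n ((w @ r) @ rev r) = level_quot n ((w' @ r) @ rev r)" by (rule level_quot_append) (rule HOL.refl)
    then show "x = y" unfolding w canc .
  qed
  moreover have "h ` fiber n dihedral_one = fiber n g"
  proof
    show "h ` fiber n dihedral_one \<subseteq> fiber n g"
    proof
      fix y assume "y \<in> h ` fiber n dihedral_one"
      then obtain w where w: "y = level_quot n (w @ r)" "dihedral w = dihedral_one" unfolding fiber_def using h by blast
      then have "dihedral (w @ r) = g" using dihedral_left[of w "[]" r] r by simp
      with w show "y \<in> fiber n g" unfolding fiber_def by blast
    qed
    show "fiber n g \<subseteq> h ` fiber n dihedral_one"
    proof
      fix y assume "y \<in> fiber n g"
      then obtain w where w: "y = level_quot n w" "dihedral w = g" by (auto simp: fiber_def)
      then have "dihedral (w @ rev r) = dihedral (r @ rev r)" using dihedral_left[of w r "rev r"] r by simp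
      then have "dihedral (w @ rev r) = dihedral_one" using dihedral_weq[OF weq_rev_right[of 0 r]] by simp
      moreover have "y = h (level_quot n (w @ rev r))" unfolding h canc' by (rule w)
      ultimately show "y \<in> h ` fiber n dihedral_one" unfolding fiber_def by blast
    qed
  qed
  ultimately show ?thesis using card_image[of h "fiber n dihedral_one"] by simp
qed

lemma card_range_level_quot: "card (range (level_quot n)) = 8 * card (fiber n dihedral_one)"
proof -
  let ?D = "{g :: bool list. set g \<subseteq> UNIV \<and> length g = 3}"
  have D: "finite ?D" "card ?D = 8"
    using finite_lists_length_eq[of "UNIV :: bool set" 3] card_lists_length_eq[of "UNIV :: bool set" 3] by simp_all
  have "dihedral w \<in> ?D" for w by (simp add: dihedral_def)
  then have "range (level_quot n) = (\<Union>g\<in>?D. fiber n g)" unfolding fiber_def by blast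
  also have "card ... = (\<Sum>g\<in>?D. card (fiber n g))"
  proof (rule card_UN_disjoint[OF D(1)])
    show "\<forall>g\<in>?D. finite (fiber n g)" using finite_fiber by blast
    show "\<forall>g\<in>?D. \<forall>g'\<in>?D. g \<noteq> g' \<longrightarrow> fiber n g \<inter> fiber n g' = {}"
      unfolding fiber_def by (blast dest: dihedral_if_level_quot)
  qed
  also have "... = (\<Sum>g\<in>?D. card (fiber n dihedral_one))" by (intro sum.cong card_fiber) auto
  finally show ?thesis using D(2) by simp
qed

text \<open>The condition that cuts the image of the even words out of the direct product;
  \<open>ex_sec\<close> shows that it suffices.\<close>

lemma dihedral_sec0_sigma_sec: "dihedral (sec0_sigma (sec i w)) = dihedral (sec (\<not> i) w)"
proof (induction w arbitrary: i)
  case (Cons x w)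
  have e: "dihedral (Gc # z) = dihedral (Gd # z)" "dihedral (Gb # z) = dihedral z" for z by (auto simp: dihedral_def)
  note R = dihedral_right[OF Cons[of i], of "[Ga]"] dihedral_right[OF Cons[of i], of "[Gd]"]
  show ?case using Cons[of i] Cons[of "\<not> i"] R by (cases x; cases i) (auto simp: e)
qed simp

lemma ex_sec:
  assumes "dihedral y = dihedral (sec0_sigma x)"
  shows "\<exists>w. \<not> par w \<and> weq n (sec False w) x \<and> weq n (sec True w) y"
proof -
  \<comment> \<open>k has trivial dihedral image, so f(k) = 1 for f = \<open>sec0_sigma\<close>, and
    the sections of the witness below are x f(k) = x and f(x) k = y.\<close>
  define k where "k = rev (sec0_sigma x) @ y"
  have "dihedral k = dihedral (rev (sec0_sigma x) @ sec0_sigma x)" unfolding k_def by (rule dihedral_right[OF assms])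
  then have k: "dihedral k = dihedral_one" using dihedral_weq[OF weq_rev_left[of 0 "sec0_sigma x"]] by simp
  show ?thesis
  proof (intro exI[of _ "conj_sigma x @ sigma_list k"] conjI)
    show "weq n (sec False (conj_sigma x @ sigma_list k)) x"
      using weq_app_left[OF sec0_sigma_trivial[OF k, of n], of x] by (simp only: sec_conj_sigma_sigma_list append_Nil2)
    show "weq n (sec True (conj_sigma x @ sigma_list k)) y"
      using weq_app_right[OF weq_rev_right[of n "sec0_sigma x"], of y] by (simp only: sec_conj_sigma_sigma_list k_def append_assoc append_Nil)
  qed (simp add: conj_sigma_def)
qed

text \<open>Even elements correspond to pairs (x, y) with y in the fibre over the dihedral image of
  \<open>sec0_sigma x\<close>. Prepending a exchanges the sections and gives the odd elements,
  doubling the count.\<close>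

lemma card_range_level_quot_Suc: "card (range (level_quot (Suc n))) = 2 * card (range (level_quot n)) * card (fiber n dihedral_one)"
proof -
  define G where "G x = dihedral (sec0_sigma (SOME w. level_quot n w = x))" for x
  have sec0_sigma_dihedral: "dihedral (sec0_sigma w) = dihedral (sec0_sigma w')" if "dihedral w = dihedral w'" for w w'
    using dihedral_weq[OF sec0_sigma_weq[of w]] dihedral_weq[OF sec0_sigma_weq[of w']] that by (simp add: dihedral_part_def dihedral_def)
  have G: "G (level_quot n w) = dihedral (sec0_sigma w)" for w
    unfolding G_def by (rule sec0_sigma_dihedral, rule dihedral_if_level_quot[of n], rule someI[of _ w]) simp
  define S where "S = (SIGMA x : range (level_quot n). fiber n (G x))"
  have lG: "length (G x) = 3" for x by (simp add: G_def dihedral_def)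
  have "card S = (\<Sum>x\<in>range (level_quot n). card (fiber n (G x)))"
    unfolding S_def by (simp add: card_SigmaI finite_level_quot finite_fiber)
  also have "\<dots> = (\<Sum>x\<in>range (level_quot n). card (fiber n dihedral_one))" by (rule sum.cong[OF HOL.refl card_fiber[OF lG]])
  finally have cS: "card S = card (range (level_quot n)) * card (fiber n dihedral_one)" by simp
  have finS: "finite S" unfolding S_def by (intro finite_SigmaI finite_level_quot finite_fiber)
  have even: "(level_quot n (sec False w), level_quot n (sec True w)) \<in> S" for w
    using dihedral_sec0_sigma_sec[of False w] by (auto simp: S_def fiber_def G)
  have S: "\<exists>w. \<not> par w \<and> s = (level_quot n (sec False w), level_quot n (sec True w))" if "s \<in> S" for s
  proof -
    from that obtain x y where "s = (level_quot n x, level_quot n y)" "dihedral y = dihedral (sec0_sigma x)"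
      by (auto simp: S_def fiber_def G)
    with ex_sec[of y x n] level_quot_weq show ?thesis by metis
  qed
  let ?e = "\<lambda>(x, y). False # x @ y" and ?o = "\<lambda>(x, y). True # y @ x"
  have "level_quot (Suc n) w \<in> ?e ` S \<union> ?o ` S" for w
  proof (cases "par w")
    case True
    then show ?thesis using even[of "Ga # w"] by (force simp: level_quot.simps(2))
  next
    case False
    then show ?thesis using even[of w] by (force simp: level_quot.simps(2))
  qed
  moreover have "?e s \<in> range (level_quot (Suc n)) \<and> ?o s \<in> range (level_quot (Suc n))" if s: "s \<in> S" for s
  proof -
    obtain w where "\<not> par w" "s = (level_quot n (sec False w), level_quot n (sec True w))" using S[OF s] by blast
    then have "?e s = level_quot (Suc n) w" "?o s = level_quot (Suc n) (Ga # w)" by (simp_all add: level_quot.simps(2))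
    then show ?thesis by simp
  qed
  ultimately have "range (level_quot (Suc n)) = ?e ` S \<union> ?o ` S" by blast
  moreover have "card (?e ` S \<union> ?o ` S) = card (?e ` S) + card (?o ` S)"
    using finS by (intro card_Un_disjoint) auto
  moreover have len: "length x = 5 * 2 ^ n - 1 \<and> length y = 5 * 2 ^ n - 1" if "(x, y) \<in> S" for x y
    using that length_level_quot by (auto simp: S_def fiber_def)
  have "card (?e ` S) = card S" "card (?o ` S) = card S"
    by (intro card_image inj_onI; use len in force)+
  ultimately show ?thesis using cS by simp
qed

lemma card_level_quot: "card (range (level_quot n)) = 2 ^ (2 ^ (n + 1) + 2)"
proof (induction n)
  case 0
  have "range (level_quot 0) = {xs. set xs \<subseteq> UNIV \<and> length xs = 4}"
  proof (intro equalityI subsetI)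
    fix xs :: "bool list" assume "xs \<in> {xs. set xs \<subseteq> UNIV \<and> length xs = 4}"
    then obtain p e f z where xs: "xs = [p, e, f, z]"
      by (auto simp: length_Suc_conv numeral_eq_Suc)
    have "level_quot 0 (bpow z @ dihedral_word p e f) = xs"
      by (cases p; cases e; cases f; cases z; simp add: xs quot16_def bpow_def dihedral_word_def)
    then show "xs \<in> range (level_quot 0)" by blast
  qed (auto simp: quot16_def)
  then show ?case using card_lists_length_eq[of "UNIV :: bool set" 4] by simp
next
  case (Suc n)
  let ?m = "card (range (level_quot n))"
  \<comment> \<open>The eight fibres have m/8 elements each, so the next size is 2m(m/8) = m^2/4:
    the exponent doubles and drops by 2.\<close>
  have "4 * card (range (level_quot (Suc n))) = ?m * ?m"
    using card_range_level_quot_Suc[of n] card_range_level_quot[of n] by simp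
  also have "... = 4 * 2 ^ (2 ^ (Suc n + 1) + 2)"
    unfolding Suc by (simp flip: power_add)
  finally show ?case by simp
qed

subsection \<open>The isomorphism\<close>

text \<open>The lowest binary digit of \<open>i\<close> selects the section, the other digits the
  coordinate within it.\<close>

fun free_coords :: "nat \<Rightarrow> gen list \<Rightarrow> nat \<Rightarrow> nat word" where
  "free_coords 0 w i = fst (theta w)"
| "free_coords (Suc n) w i = free_coords n (sec (odd i) w) (i div 2)"

lemma rank3_free_coords: "rank3 (free_coords n w i)"
  by (induction n arbitrary: w i) (auto simp: rank3_theta)

lemma free_coords_weq: "weq n x y \<Longrightarrow> feq (free_coords n x i) (free_coords n y i)"
proof (induction n arbitrary: x y i)
  case 0 then show ?case using acts_weq[of x y "([], False)"] by (simp add: theta_def state_eq_def)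
qed (auto intro: sec_weq)

lemma weq_iota_theta:
  assumes "quot16 w = quot16_one" shows "weq 0 w (iota (fst (theta w)))"
  using weq_bpart_dihedral_part[of w] dihedral_part_trivial[of w] assms snd_theta[of w]
  by (simp add: quot16_dihedral bpart_def bpow_def)

text \<open>In the base case x equals \<open>iota (fst (theta x))\<close> in \<open>G_0\<close> and
  so acts by left translation; the sections of an even product are products of sections.\<close>

lemma free_coords_append:
  "level_quot n x = level_quot n [] \<Longrightarrow> level_quot n y = level_quot n [] \<Longrightarrow> feq (free_coords n (x @ y) i) (free_coords n x i @ free_coords n y i)"
proof (induction n arbitrary: x y i)
  case 0
  then have x: "quot16 x = quot16_one" and y: "quot16 y = quot16_one" by auto
  have e: "theta y = (fst (theta y), False)" using y snd_theta[of y] by (simp add: quot16_def prod_eq_iff)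
  have "state_eq (acts x (theta y)) (acts (iota (fst (theta x))) (theta y))"
    by (rule acts_weq[OF weq_iota_theta[OF x]])
  also have "state_eq ... (fst (theta x) @ fst (theta y), False)"
    using acts_iota[OF rank3_theta[of x], of "fst (theta y)" False] e by simp
  finally show ?case by (simp add: theta_def state_eq_def)
next
  case (Suc n)
  then show ?case by (simp add: level_quot_Suc_Nil)
qed

lemma free_coords_inj:
  "level_quot n x = level_quot n [] \<Longrightarrow> (\<And>i. i < 2 ^ n \<Longrightarrow> feq (free_coords n x i) []) \<Longrightarrow> weq n x []"
proof (induction n arbitrary: x)
  case 0
  have "weq 0 x (iota (fst (theta x)))" using 0 by (intro weq_iota_theta) simp
  also have "weq 0 ... (iota [])" using 0(2)[of 0] by (intro iota_feq) simp
  finally show ?case by simp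
next
  case (Suc n)
  show ?case
  proof (rule weq_Nil_if_sec)
    show "\<not> par x" using Suc.prems(1) by (simp add: level_quot_Suc_Nil)
    fix j
    show "weq n (sec j x) []"
    proof (rule Suc.IH)
      show "level_quot n (sec j x) = level_quot n []" using Suc.prems(1) by (simp add: level_quot_Suc_Nil)
      fix i :: nat assume "i < 2 ^ n"
      \<comment> \<open>Coordinate i of section j is coordinate 2i + j of x.\<close>
      then show "feq (free_coords n (sec j x) i) []"
        using Suc.prems(2)[of "2 * i + of_bool j"] by (cases j) simp_all
    qed
  qed
qed

text \<open>The entries of even and of odd index are realised by x and y separately. Both have
  trivial dihedral image, so the fibre condition holds and \<open>ex_sec\<close> combines
  them.\<close>

lemma free_coords_surj:
  "(\<And>i. rank3 (fs i)) \<Longrightarrow> \<exists>w. level_quot n w = level_quot n [] \<and> (\<forall>i<2 ^ n. feq (free_coords n w i) (fs i))"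
proof (induction n arbitrary: fs)
  case 0
  have z: "quot16 (iota w) = quot16_one" if "rank3 w" for w
    using that
  proof (induction w)
    case (Cons x w)
    then have "rank3 w" by (cases x) auto
    have "quot16 (iota_letter x) = quot16_one" using Cons.prems by (cases x rule: rank3_letter_cases) (simp_all add: iota_letter_def quot16_def)
    then show ?case using Cons.IH[OF \<open>rank3 w\<close>] quot16_append_quot16_one by simp
  qed simp
  have "feq (fst (theta (iota (fs 0)))) (fs 0)"
    using acts_iota[of "fs 0" "[]" False] 0 by (simp add: theta_def state_eq_def)
  then show ?case using z[of "fs 0"] 0 by (intro exI[of _ "iota (fs 0)"]) simp
next
  case (Suc n)
  obtain x where x: "level_quot n x = level_quot n []" "\<forall>i<2 ^ n. feq (free_coords n x i) (fs (2 * i))"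
    using Suc.IH[of "\<lambda>i. fs (2 * i)"] Suc.prems by blast
  obtain y where y: "level_quot n y = level_quot n []" "\<forall>i<2 ^ n. feq (free_coords n y i) (fs (2 * i + 1))"
    using Suc.IH[of "\<lambda>i. fs (2 * i + 1)"] Suc.prems by blast
  have "dihedral (sec0_sigma x) = dihedral_one" using dihedral_weq[OF sec0_sigma_trivial[of x 0]] dihedral_if_level_quot[OF x(1)] by simp
  then obtain w where w: "\<not> par w" "weq n (sec False w) x" "weq n (sec True w) y"
    using ex_sec[of y x n] dihedral_if_level_quot[OF y(1)] by auto
  have "level_quot (Suc n) w = level_quot (Suc n) []"
    using level_quot_weq[OF w(2)] level_quot_weq[OF w(3)] w(1) x(1) y(1) by (simp add: level_quot_Suc_eq)
  moreover have "feq (free_coords (Suc n) w i) (fs i)" if "i < 2 ^ Suc n" for i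
  proof -
    have d: "i div 2 < 2 ^ n" using that by auto
    show ?thesis
    proof (cases "odd i")
      case True
      then have "feq (free_coords n (sec True w) (i div 2)) (fs (2 * (i div 2) + 1))"
        using d y(2) free_coords_weq[OF w(3)] pres_eq.pe_trans by blast
      then show ?thesis using True by simp
    next
      case False
      then have "feq (free_coords n (sec False w) (i div 2)) (fs (2 * (i div 2)))"
        using d x(2) free_coords_weq[OF w(2)] pres_eq.pe_trans by blast
      then show ?thesis using False by simp
    qed
  qed
  ultimately show ?case by blast
qed

section \<open>Passage from unsigned words to the presented groups\<close>

lemma pclass_eq_iff: "pclass R x = pclass R y \<longleftrightarrow> pres_eq R x y"
  unfolding pclass_def by (auto intro: pres_eq.intros)

lemma carrier_pres_group: "carrier (pres_group S R) = pclass R ` lists (S \<times> UNIV)"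
  and one_pres_group: "\<one>\<^bsub>pres_group S R\<^esub> = pclass R []"
  by (simp_all add: pres_group_def)

lemma mult_pres_group: "pclass R x \<otimes>\<^bsub>pres_group S R\<^esub> pclass R y = pclass R (x @ y)"
proof -
  have "pres_eq R (x' @ y') w \<longleftrightarrow> pres_eq R (x @ y) w" if "pres_eq R x x'" "pres_eq R y y'" for x' y' w
    using pres_eq_append[OF that] by (meson pres_eq.pe_sym pres_eq.pe_trans)
  then show ?thesis unfolding pres_group_def pclass_def by (auto intro: pres_eq.pe_refl)
qed

lemma inv_word_lists: "w \<in> lists (S \<times> UNIV) \<Longrightarrow> inv_word w \<in> lists (S \<times> UNIV)"
  by (fastforce simp: inv_word_def inv_letter_def in_lists_conv_set)

lemma group_pres_group: "group (pres_group S R)"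
proof (rule groupI)
  fix P assume "P \<in> carrier (pres_group S R)"
  then obtain w where w: "w \<in> lists (S \<times> UNIV)" "P = pclass R w" by (auto simp: carrier_pres_group)
  show "\<exists>Y\<in>carrier (pres_group S R). Y \<otimes>\<^bsub>pres_group S R\<^esub> P = \<one>\<^bsub>pres_group S R\<^esub>"
    using inv_word_lists[OF w(1)] pres_eq_inv_left[of R w] w(2)
    by (auto simp: carrier_pres_group one_pres_group mult_pres_group pclass_eq_iff
        intro!: bexI[of _ "inv_word w"])
next
  fix P P' assume "P \<in> carrier (pres_group S R)" "P' \<in> carrier (pres_group S R)"
  then obtain x y where xy: "x \<in> lists (S \<times> UNIV)" "y \<in> lists (S \<times> UNIV)"
    and P: "P = pclass R x" "P' = pclass R y"
    unfolding carrier_pres_group by blast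
  have "x @ y \<in> lists (S \<times> UNIV)" using xy by simp
  then show "P \<otimes>\<^bsub>pres_group S R\<^esub> P' \<in> carrier (pres_group S R)"
    unfolding carrier_pres_group P mult_pres_group by (rule imageI)
qed (auto simp: carrier_pres_group one_pres_group mult_pres_group)

lemma sigma_map_lt: "sigma (map lt w) = map lt (sigma_list w)"
proof (induction w)
  case (Cons x w)
  then show ?case by (cases x) (auto simp: sigma_def subst_def lt_def)
qed (simp add: sigma_def subst_def)

lemma sigma_pow_map_lt: "(sigma ^^ n) (map lt w) = map lt ((sigma_list ^^ n) w)"
  by (induction n) (auto simp: sigma_map_lt)

lemma sigma_list_pow_fourth: "(sigma_list ^^ n) (fourth w) = fourth ((sigma_list ^^ n) w)"
  by (induction n) (auto simp: sigma_list_fourth)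

lemma u_eq: "u n = map lt (u_list n)" and v_eq: "v n = map lt (v_list n)"
proof -
  have "u0 = map lt (fourth [Ga, Gd])" "v0 = map lt (fourth [Ga, Gd, Ga, Gc, Ga, Gc])"
    by (simp_all add: u0_def v0_def fourth_def numeral_eq_Suc)
  then show "u n = map lt (u_list n)" "v n = map lt (v_list n)"
    unfolding u_def v_def u_list_def v_list_def sigma_list_pow_fourth[symmetric] sigma_pow_map_lt[symmetric] by simp_all
qed

lemma rels_eq: "rels n = map lt ` rel_list n"
  unfolding rels_def rel_list_def base_rels_def base_list_def u_eq v_eq by auto

lemma map_fst_lt [simp]: "map fst (map lt w) = w"
  by (induction w) (auto simp: lt_def)

lemma weq_if_pres_eq: "pres_eq (rels n) x y \<Longrightarrow> weq n (map fst x) (map fst y)"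
proof (induction rule: pres_eq.induct)
  case (pe_cancel x l y)
  show ?case using weq_mid[OF weq_double[of n "fst l" "[]"], of "map fst x" "map fst y"]
    by (simp add: inv_letter_def)
next
  case (pe_rel r x y)
  then have "map fst r \<in> rel_list n" by (auto simp: rels_eq simp del: map_map)
  then show ?case using weq.rel by simp
qed (auto intro: weq.intros)

lemma pres_eq_if_weq: "weq n x y \<Longrightarrow> pres_eq (rels n) (map lt x) (map lt y)"
proof (induction rule: weq.induct)
  case (rel r x y)
  then show ?case using pres_eq.pe_rel[of "map lt r" "rels n" "map lt x" "map lt y"] by (simp add: rels_eq)
qed (auto intro: pres_eq.intros)

lemma pres_eq_unsigned: "pres_eq (rels n) w (map lt (map fst w))"
proof (induction w)
  case Nil show ?case by (simp add: pres_eq.pe_refl)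
next
  case (Cons x w)
  obtain g s where x: "x = (g, s)" by (cases x)
  have "pres_eq (rels n) [x] [lt g]"
  proof (cases s)
    case True
    have "pres_eq (rels n) ([lt g, lt g] @ [x]) ([] @ [x])"
      using pres_eq_app_right[OF pres_eq_if_weq[OF weq_double[of n g "[]"]], of "[x]"] by simp
    moreover have "pres_eq (rels n) ([lt g] @ [lt g, inv_letter (lt g)] @ []) ([lt g] @ [])"
      by (rule pres_eq.pe_cancel)
    ultimately show ?thesis using x True
      by (simp add: lt_def inv_letter_def) (meson pres_eq.pe_sym pres_eq.pe_trans)
  qed (simp add: x lt_def pres_eq.pe_refl)
  from pres_eq_append[OF this Cons] show ?case by (simp add: x)
qed

definition grig_class :: "nat \<Rightarrow> gen list \<Rightarrow> gen word set" where
  "grig_class n w = pclass (rels n) (map lt w)"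

lemma grig_class_eq_iff: "grig_class n x = grig_class n y \<longleftrightarrow> weq n x y"
  unfolding grig_class_def pclass_eq_iff using weq_if_pres_eq[of n "map lt x" "map lt y"] pres_eq_if_weq[of n x y]
  unfolding map_fst_lt by blast

lemma carrier_Grig: "carrier (Grig n) = range (grig_class n)"
proof -
  have "pclass (rels n) w = grig_class n (map fst w)" for w
    unfolding grig_class_def pclass_eq_iff by (rule pres_eq_unsigned)
  then have "range (pclass (rels n)) = range (grig_class n)" unfolding grig_class_def by blast
  then show ?thesis unfolding Grig_def carrier_pres_group by simp
qed

lemma mult_Grig: "grig_class n x \<otimes>\<^bsub>Grig n\<^esub> grig_class n y = grig_class n (x @ y)"
  and one_Grig: "\<one>\<^bsub>Grig n\<^esub> = grig_class n []"
  by (simp_all add: Grig_def grig_class_def mult_pres_group one_pres_group)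

lemma group_Grig: "group (Grig n)"
  unfolding Grig_def by (rule group_pres_group)

lemma inv_Grig: "inv\<^bsub>Grig n\<^esub> (grig_class n x) = grig_class n (rev x)"
  by (rule group.inv_equality[OF group_Grig])
    (simp_all add: mult_Grig one_Grig carrier_Grig grig_class_eq_iff weq_rev_left rangeI)

section \<open>The normal subgroup \<open>H_n\<close> and its index\<close>

definition branch_kernel :: "nat \<Rightarrow> gen word set set" where
  "branch_kernel n = grig_class n ` {w. level_quot n w = level_quot n []}"

lemma level_quot_rev: assumes "level_quot n x = level_quot n y" shows "level_quot n (rev x) = level_quot n (rev y)"
proof -
  have "level_quot n (rev x) = level_quot n (rev x @ (y @ rev y))"
    using level_quot_append[OF _ level_quot_weq[OF weq_rev_right[of n y]], of "rev x" "rev x"] by simp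
  also have "\<dots> = level_quot n ((rev x @ x) @ rev y)"
    using level_quot_append[OF level_quot_append[OF HOL.refl assms[symmetric]] HOL.refl, of "rev x" "rev y"] by simp
  also have "\<dots> = level_quot n (rev y)"
    using level_quot_append[OF level_quot_weq[OF weq_rev_left[of n x]], of "rev y" "rev y"] by simp
  finally show ?thesis .
qed

lemma branch_kernel_normal: "branch_kernel n \<lhd> Grig n"
proof -
  have "subgroup (branch_kernel n) (Grig n)"
  proof (rule group.subgroupI[OF group_Grig])
    show "branch_kernel n \<subseteq> carrier (Grig n)" by (auto simp: branch_kernel_def carrier_Grig)
    show "branch_kernel n \<noteq> {}" by (auto simp: branch_kernel_def)
    fix P assume "P \<in> branch_kernel n"
    then obtain x where x: "P = grig_class n x" "level_quot n x = level_quot n []" unfolding branch_kernel_def by blast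
    show "inv\<^bsub>Grig n\<^esub> P \<in> branch_kernel n"
      unfolding x(1) inv_Grig branch_kernel_def using level_quot_rev[OF x(2)] by simp
    fix P' assume "P' \<in> branch_kernel n"
    then obtain y where y: "P' = grig_class n y" "level_quot n y = level_quot n []" unfolding branch_kernel_def by blast
    show "P \<otimes>\<^bsub>Grig n\<^esub> P' \<in> branch_kernel n"
      unfolding x(1) y(1) mult_Grig branch_kernel_def using level_quot_append[OF x(2) y(2)] by simp
  qed
  moreover have "P \<otimes>\<^bsub>Grig n\<^esub> P' \<otimes>\<^bsub>Grig n\<^esub> inv\<^bsub>Grig n\<^esub> P \<in> branch_kernel n"
    if P: "P \<in> carrier (Grig n)" and P': "P' \<in> branch_kernel n" for P P'
  proof -
    obtain x where x: "P = grig_class n x" using P by (auto simp: carrier_Grig)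
    obtain y where y: "P' = grig_class n y" "level_quot n y = level_quot n []" using P' unfolding branch_kernel_def by blast
    have "level_quot n ((x @ y) @ rev x) = level_quot n ((x @ []) @ rev x)"
      by (intro level_quot_append HOL.refl y(2))
    also have "\<dots> = level_quot n []" using level_quot_weq[OF weq_rev_right[of n x]] by simp
    finally show ?thesis unfolding x y(1) inv_Grig mult_Grig branch_kernel_def by blast
  qed
  ultimately show ?thesis using group.normal_inv_iff[OF group_Grig] by blast
qed

text \<open>Cosets are the fibres of \<open>level_quot\<close>, so the index is the number of its
  values.\<close>

lemma rcoset_branch_kernel: "branch_kernel n #>\<^bsub>Grig n\<^esub> grig_class n w = grig_class n ` {x. level_quot n x = level_quot n w}"
proof
  show "branch_kernel n #>\<^bsub>Grig n\<^esub> grig_class n w \<subseteq> grig_class n ` {x. level_quot n x = level_quot n w}"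
  proof
    fix P assume "P \<in> branch_kernel n #>\<^bsub>Grig n\<^esub> grig_class n w"
    then obtain x where "P = grig_class n (x @ w)" "level_quot n x = level_quot n []"
      by (auto simp: r_coset_def branch_kernel_def mult_Grig)
    then show "P \<in> grig_class n ` {x. level_quot n x = level_quot n w}" using level_quot_append[of n x "[]" w w] by auto
  qed
  show "grig_class n ` {x. level_quot n x = level_quot n w} \<subseteq> branch_kernel n #>\<^bsub>Grig n\<^esub> grig_class n w"
  proof
    fix P assume "P \<in> grig_class n ` {x. level_quot n x = level_quot n w}"
    then obtain x where x: "P = grig_class n x" "level_quot n x = level_quot n w" by blast
    have "level_quot n (x @ rev w) = level_quot n (w @ rev w)" by (intro level_quot_append x(2) HOL.refl)
    also have "\<dots> = level_quot n []" by (rule level_quot_weq[OF weq_rev_right])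
    finally have "grig_class n (x @ rev w) \<in> branch_kernel n" unfolding branch_kernel_def by blast
    moreover have "P = grig_class n (x @ rev w) \<otimes>\<^bsub>Grig n\<^esub> grig_class n w"
      unfolding x(1) mult_Grig grig_class_eq_iff
      using weq.sym[OF weq_app_left[OF weq_rev_left[of n w], of x]] by simp
    ultimately show "P \<in> branch_kernel n #>\<^bsub>Grig n\<^esub> grig_class n w" unfolding r_coset_def by blast
  qed
qed

lemma card_rcosets_branch_kernel: "card (rcosets\<^bsub>Grig n\<^esub> branch_kernel n) = 2 ^ (2 ^ (n + 1) + 2)"
proof -
  let ?K = "\<lambda>y. grig_class n ` {x. level_quot n x = y}"
  have "rcosets\<^bsub>Grig n\<^esub> branch_kernel n = ?K ` range (level_quot n)"
    unfolding RCOSETS_def carrier_Grig by (auto simp: rcoset_branch_kernel)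
  moreover have "inj_on ?K (range (level_quot n))"
  proof (rule inj_onI)
    fix y y' assume "y \<in> range (level_quot n)" "y' \<in> range (level_quot n)" and e: "?K y = ?K y'"
    then obtain w where w: "y = level_quot n w" by blast
    then have "grig_class n w \<in> ?K y'" using e by blast
    then obtain x where "weq n w x" "level_quot n x = y'" using grig_class_eq_iff by blast
    then show "y = y'" using w level_quot_weq[of n w x] by simp
  qed
  ultimately show ?thesis using card_image[of ?K "range (level_quot n)"] card_level_quot[of n] by simp
qed

section \<open>The isomorphism with the product of free groups\<close>

lemma iso_branch_kernel: "(Grig n)\<lparr>carrier := branch_kernel n\<rparr> \<cong> product_group {..<(2::nat) ^ n} (\<lambda>_. free_group3)"
proof -
  let ?P = "product_group {..<(2::nat) ^ n} (\<lambda>_. free_group3)"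
  \<comment> \<open>A word is chosen in each class, immaterially by \<open>free_coords_weq\<close>;
    the restriction makes the value extensional, as elements of \<open>product_group\<close>
    are.\<close>
  define h where "h P = (\<lambda>i\<in>{..<(2::nat) ^ n}. pclass {} (free_coords n (SOME w. P = grig_class n w) i))" for P
  have h: "h (grig_class n w) = (\<lambda>i\<in>{..<2 ^ n}. pclass {} (free_coords n w i))" for w
  proof -
    have "weq n w (SOME x. grig_class n w = grig_class n x)"
      using someI[of "\<lambda>x. grig_class n w = grig_class n x" w] by (simp add: grig_class_eq_iff)
    then have "pclass {} (free_coords n (SOME x. grig_class n w = grig_class n x) i) = pclass {} (free_coords n w i)" for i
      unfolding pclass_eq_iff by (intro pres_eq.pe_sym[OF free_coords_weq])
    then show ?thesis unfolding h_def by simp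
  qed
  have carF: "carrier free_group3 = pclass {} ` {w. rank3 w}"
    by (auto simp: free_group3_def carrier_pres_group rank3_def)
  have hom: "h \<in> hom ((Grig n)\<lparr>carrier := branch_kernel n\<rparr>) ?P"
  proof (rule homI)
    fix P assume "P \<in> carrier ((Grig n)\<lparr>carrier := branch_kernel n\<rparr>)"
    then obtain x where x: "P = grig_class n x" "level_quot n x = level_quot n []" unfolding branch_kernel_def by auto
    show "h P \<in> carrier ?P" by (auto simp: x(1) h product_group_def carF rank3_free_coords)
    fix P' assume "P' \<in> carrier ((Grig n)\<lparr>carrier := branch_kernel n\<rparr>)"
    then obtain y where y: "P' = grig_class n y" "level_quot n y = level_quot n []" unfolding branch_kernel_def by auto
    have "pclass {} (free_coords n (x @ y) i) = pclass {} (free_coords n x i) \<otimes>\<^bsub>free_group3\<^esub> pclass {} (free_coords n y i)" for i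
      unfolding free_group3_def mult_pres_group pclass_eq_iff by (rule free_coords_append[OF x(2) y(2)])
    then show "h (P \<otimes>\<^bsub>(Grig n)\<lparr>carrier := branch_kernel n\<rparr>\<^esub> P') = h P \<otimes>\<^bsub>?P\<^esub> h P'"
      by (auto simp: x(1) y(1) mult_Grig h product_group_def intro: restrict_ext)
  qed
  have "inj_on h (branch_kernel n)"
  proof (rule inj_onI)
    fix P P' assume "P \<in> branch_kernel n" "P' \<in> branch_kernel n" and e: "h P = h P'"
    then obtain x y where x: "P = grig_class n x" "level_quot n x = level_quot n []" and y: "P' = grig_class n y" "level_quot n y = level_quot n []"
      unfolding branch_kernel_def by blast
    have ry: "level_quot n (rev y) = level_quot n []" using level_quot_rev[OF y(2)] by simp
    have "weq n (x @ rev y) []"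
    proof (rule free_coords_inj)
      show "level_quot n (x @ rev y) = level_quot n []" using level_quot_append[OF x(2) ry] by simp
      fix i :: nat assume i: "i < 2 ^ n"
      have "feq (free_coords n x i) (free_coords n y i)"
        using fun_cong[OF e, of i] i by (simp add: x(1) y(1) h pclass_eq_iff)
      have "feq (free_coords n (x @ rev y) i) (free_coords n x i @ free_coords n (rev y) i)" by (rule free_coords_append[OF x(2) ry])
      also have "feq \<dots> (free_coords n y i @ free_coords n (rev y) i)" by (rule pres_eq_app_right) fact
      also have "feq \<dots> (free_coords n (y @ rev y) i)" by (rule pres_eq.pe_sym[OF free_coords_append[OF y(2) ry]])
      also have "feq \<dots> (free_coords n [] i)" by (rule free_coords_weq[OF weq_rev_right])
      also have "free_coords n [] i = []" by (induction n arbitrary: i) (auto simp: theta_def)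
      finally show "feq (free_coords n (x @ rev y) i) []" .
    qed
    then have "weq n (x @ rev y @ y) y" using weq_app_right[of n "x @ rev y" "[]" y] by simp
    then have "weq n x y"
      using weq_app_left[OF weq_rev_left[of n y], of x] by (simp, meson weq.sym weq.trans)
    then show "P = P'" by (simp add: x(1) y(1) grig_class_eq_iff)
  qed
  moreover have "h ` branch_kernel n = carrier ?P"
  proof
    show "h ` branch_kernel n \<subseteq> carrier ?P" using hom_carrier[OF hom] by simp
    show "carrier ?P \<subseteq> h ` branch_kernel n"
    proof
      fix F assume F: "F \<in> carrier ?P"
      \<comment> \<open>Outside the index range the empty word serves as default, so that
        \<open>rank3 (fs i)\<close> holds for every i, as \<open>free_coords_surj\<close>
        asks.\<close>
      have "\<exists>w. rank3 w \<and> (i < 2 ^ n \<longrightarrow> F i = pclass {} w)" for i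
      proof (cases "i < 2 ^ n")
        case True
        then have "F i \<in> carrier free_group3" using F by (auto simp: product_group_def PiE_iff)
        then show ?thesis by (auto simp: carF)
      next
        case False
        then show ?thesis by (intro exI[of _ "[]"]) simp
      qed
      then have "\<forall>i. \<exists>w. rank3 w \<and> (i < 2 ^ n \<longrightarrow> F i = pclass {} w)" by blast
      from choice[OF this] obtain fs where fs: "\<And>i. rank3 (fs i)" "\<And>i. i < 2 ^ n \<Longrightarrow> F i = pclass {} (fs i)"
        by blast
      obtain w where w: "level_quot n w = level_quot n []" "\<forall>i<2 ^ n. feq (free_coords n w i) (fs i)"
        using free_coords_surj[of fs n] fs(1) by blast
      have "F = h (grig_class n w)"
      proof
        fix i show "F i = h (grig_class n w) i"
        proof (cases "i < 2 ^ n")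
          case True
          then have "pclass {} (fs i) = pclass {} (free_coords n w i)"
            unfolding pclass_eq_iff by (intro pres_eq.pe_sym[OF w(2)[rule_format]])
          then show ?thesis using True fs(2) by (simp add: h)
        next
          case False
          have "F \<in> (\<Pi>\<^sub>E i\<in>{..<2 ^ n}. carrier free_group3)" using F by simp
          from PiE_arb[OF this, of i] False show ?thesis by (simp add: h)
        qed
      qed
      then show "F \<in> h ` branch_kernel n" using w(1) unfolding branch_kernel_def by blast
    qed
  qed
  ultimately have "h \<in> iso ((Grig n)\<lparr>carrier := branch_kernel n\<rparr>) ?P"
    unfolding iso_def bij_betw_def using hom by simp
  then show ?thesis by (rule is_isoI)
qed

theorem theorem1p7:
  fixes n :: nat
  shows "\<exists>H. H \<lhd> Grig n
            \<and> card (rcosets\<^bsub>Grig n\<^esub> H) = 2 ^ (2 ^ (n + 1) + 2)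
            \<and> (Grig n)\<lparr>carrier := H\<rparr> \<cong> product_group {..<(2::nat) ^ n} (\<lambda>_. free_group3)"
  by (intro exI[of _ "branch_kernel n"] conjI branch_kernel_normal card_rcosets_branch_kernel iso_branch_kernel)

end
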